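(* For every stable allocation instance with rational data and a feasible rational initial allocation, random best response dynamics terminate with a stable allocation with probability one.
   Context: A stable allocation instance consists of a bipartite graph $G=(V,E)$ with color classes $J$ (jobs, the active side) and $M$ (machines, the passive side), quotas $q:V\to\mathbb{R}_{\ge 0}$, edge capacities $c:E\to\mathbb{R}_{\ge 0}$, and for every vertex $v$ a strict ranking $\mathrm{rank}_v$ of its incident edges ($uv$ dominates $wv$ at $v$ if $\mathrm{rank}_v(uv)<\mathrm{rank}_v(wv)$). An allocation is $x:E\to\mathbb{R}_{\ge0}$ with $x(e)\le c(e)$ and $x(v):=\sum_{e\in\delta(v)}x(e)\le q(v)$. Write $\bar x(e)=c(e)-x(e)$, $\bar x(v)=q(v)-x(v)$. An edge $jm$ blocks $x$ if (1) $x(jm)<c(jm)$; (2) $x(j)<q(j)$ or $j$ prefers $jm$ to its worst edge with positive value in $x$; (3) $x(m)<q(m)$ or $m$ prefers $jm$ to its worst edge with positive value in $x$. An allocation is stable if no edge blocks it. A best response step of a job $j$ having blocking edges: let $jm$ be the blocking edge of $j$ ranked highest by $j$; $x(jm)$ is increased by $A:=\min\{\bar x(j)+x(\text{edges dominated by }jm\text{ at }j),\ \bar x(jm),\ \bar x(m)+x(\text{edges dominated by }jm\text{ at }m)\}$, after which $j$ and $m$ each first use their free quota and then reduce allocation on their worst allocated edges until the allocation is feasible again. With rational data the set of allocations reachable by best response steps is finite. Random best response dynamics: as long as the current allocation is unstable, a job with a blocking edge is chosen at random, each such job with positive probability, and performs its best response step (a finite discrete-time Markov chain with stable allocations absorbing).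 *)

theory Defs
  imports "HOL-Probability.Probability"
begin

text \<open>Edges are pairs (job, machine). Ranks are numbers with smaller meaning better.\<close>

record 'v alloc_instance =
  jobs :: "'v set"
  machines :: "'v set"
  edges :: "('v \<times> 'v) set"
  quota :: "'v \<Rightarrow> real"
  capacity :: "'v \<times> 'v \<Rightarrow> real"
  ranking :: "'v \<Rightarrow> 'v \<times> 'v \<Rightarrow> nat"

definition incident :: "'v alloc_instance \<Rightarrow> 'v \<Rightarrow> ('v \<times> 'v) set" where
  "incident I v = {e \<in> edges I. fst e = v \<or> snd e = v}"

definition stable_allocation_instance :: "'v alloc_instance \<Rightarrow> bool" where
  "stable_allocation_instance I \<longleftrightarrow>
     finite (jobs I) \<and> finite (machines I) \<and> jobs I \<inter> machines I = {} \<and>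
     edges I \<subseteq> jobs I \<times> machines I \<and>
     (\<forall>v \<in> jobs I \<union> machines I. 0 \<le> quota I v) \<and>
     (\<forall>e \<in> edges I. 0 \<le> capacity I e) \<and>
     (\<forall>v \<in> jobs I \<union> machines I. inj_on (ranking I v) (incident I v))"

definition rational_data :: "'v alloc_instance \<Rightarrow> bool" where
  "rational_data I \<longleftrightarrow>
     (\<forall>v \<in> jobs I \<union> machines I. quota I v \<in> \<rat>) \<and> (\<forall>e \<in> edges I. capacity I e \<in> \<rat>)"

text \<open>Allocations are total functions; their values off the edge set are irrelevant.\<close>

type_synonym 'v assignment = "'v \<times> 'v \<Rightarrow> real"

definition load :: "'v alloc_instance \<Rightarrow> 'v assignment \<Rightarrow> 'v \<Rightarrow> real" where
  "load I x v = (\<Sum>e \<in> incident I v. x e)"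

definition allocation :: "'v alloc_instance \<Rightarrow> 'v assignment \<Rightarrow> bool" where
  "allocation I x \<longleftrightarrow>
     (\<forall>e \<in> edges I. 0 \<le> x e \<and> x e \<le> capacity I e) \<and>
     (\<forall>v \<in> jobs I \<union> machines I. load I x v \<le> quota I v)"

definition rational_allocation :: "'v alloc_instance \<Rightarrow> 'v assignment \<Rightarrow> bool" where
  "rational_allocation I x \<longleftrightarrow> allocation I x \<and> (\<forall>e \<in> edges I. x e \<in> \<rat>)"

definition dominates :: "'v alloc_instance \<Rightarrow> 'v \<Rightarrow> 'v \<times> 'v \<Rightarrow> 'v \<times> 'v \<Rightarrow> bool" where
  "dominates I v e f \<longleftrightarrow> ranking I v e < ranking I v f"

definition worst_edge :: "'v alloc_instance \<Rightarrow> 'v assignment \<Rightarrow> 'v \<Rightarrow> 'v \<times> 'v \<Rightarrow> bool" where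
  "worst_edge I x v f \<longleftrightarrow> is_arg_max (ranking I v) (\<lambda>e. e \<in> incident I v \<and> 0 < x e) f"

definition wants :: "'v alloc_instance \<Rightarrow> 'v assignment \<Rightarrow> 'v \<Rightarrow> 'v \<times> 'v \<Rightarrow> bool" where
  "wants I x v e \<longleftrightarrow>
     load I x v < quota I v \<or> (\<exists>f. worst_edge I x v f \<and> dominates I v e f)"

definition blocks :: "'v alloc_instance \<Rightarrow> 'v assignment \<Rightarrow> 'v \<times> 'v \<Rightarrow> bool" where
  "blocks I x e \<longleftrightarrow>
     e \<in> edges I \<and> x e < capacity I e \<and> wants I x (fst e) e \<and> wants I x (snd e) e"

definition stable_allocation :: "'v alloc_instance \<Rightarrow> 'v assignment \<Rightarrow> bool" where
  "stable_allocation I x \<longleftrightarrow> allocation I x \<and> \<not> (\<exists>e \<in> edges I. blocks I x e)"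

definition blocking_jobs :: "'v alloc_instance \<Rightarrow> 'v assignment \<Rightarrow> 'v set" where
  "blocking_jobs I x = {j \<in> jobs I. \<exists>e \<in> incident I j. blocks I x e}"

definition best_blocking_edge ::
  "'v alloc_instance \<Rightarrow> 'v assignment \<Rightarrow> 'v \<Rightarrow> 'v \<times> 'v" where
  "best_blocking_edge I x j = arg_min_on (ranking I j) {e \<in> incident I j. blocks I x e}"

definition available :: "'v alloc_instance \<Rightarrow> 'v assignment \<Rightarrow> 'v \<Rightarrow> 'v \<times> 'v \<Rightarrow> real" where
  "available I x v e =
     (quota I v - load I x v) + (\<Sum>f | f \<in> incident I v \<and> dominates I v e f. x f)"

fun reduce :: "real \<Rightarrow> ('v \<times> 'v) list \<Rightarrow> 'v assignment \<Rightarrow> 'v assignment" where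
  "reduce r [] x = x"
| "reduce r (e # es) x = (let d = min r (x e) in reduce (r - d) es (x(e := x e - d)))"

text \<open>
  The amount to be given up at a vertex is what the increase has put above its quota, so that
  free quota is used first; it is taken from the incident edges in order from worst to best.
\<close>

definition restore :: "'v alloc_instance \<Rightarrow> 'v \<Rightarrow> 'v assignment \<Rightarrow> 'v assignment" where
  "restore I v x =
     reduce (max 0 (load I x v - quota I v))
       (rev (sorted_key_list_of_set (ranking I v) (incident I v))) x"

definition best_response ::
  "'v alloc_instance \<Rightarrow> 'v assignment \<Rightarrow> 'v \<Rightarrow> 'v assignment" where
  "best_response I x j =
     (let e = best_blocking_edge I x j;
          m = snd e;
          A = Min {available I x j e, capacity I e - x e, available I x m e}
      in restore I m (restore I j (x(e := x e + A))))"

text \<open>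
  A selection rule gives, for the current allocation, the distribution of the job that moves.
\<close>

definition selection_rule ::
  "'v alloc_instance \<Rightarrow> ('v assignment \<Rightarrow> 'v pmf) \<Rightarrow> bool" where
  "selection_rule I S \<longleftrightarrow>
     (\<forall>x. allocation I x \<and> \<not> stable_allocation I x \<longrightarrow> set_pmf (S x) = blocking_jobs I x)"

definition dynamics_kernel ::
  "'v alloc_instance \<Rightarrow> ('v assignment \<Rightarrow> 'v pmf) \<Rightarrow> 'v assignment \<Rightarrow> 'v assignment pmf" where
  "dynamics_kernel I S x =
     (if stable_allocation I x then return_pmf x else map_pmf (best_response I x) (S x))"

definition markov_chain ::
  "('s \<Rightarrow> 's pmf) \<Rightarrow> 's \<Rightarrow> 'w measure \<Rightarrow> (nat \<Rightarrow> 'w \<Rightarrow> 's) \<Rightarrow> bool" where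
  "markov_chain K s \<Omega> X \<longleftrightarrow>
     prob_space \<Omega> \<and>
     (\<forall>n. X n \<in> measurable \<Omega> (count_space UNIV)) \<and>
     (AE \<omega> in \<Omega>. X 0 \<omega> = s) \<and>
     (\<forall>n path t.
        measure \<Omega> {\<omega> \<in> space \<Omega>. (\<forall>i\<le>n. X i \<omega> = path i) \<and> X (Suc n) \<omega> = t} =
        measure \<Omega> {\<omega> \<in> space \<Omega>. \<forall>i\<le>n. X i \<omega> = path i} * pmf (K (path n)) t)"

text \<open>Every kernel and initial state have such a chain, so the notion is never vacuous.\<close>

lemma markov_chain_exists:
  fixes K :: "'s \<Rightarrow> 's pmf" and s :: 's
  shows "\<exists>\<Omega> :: (nat \<Rightarrow> 's) measure. markov_chain K s \<Omega> (\<lambda>n \<omega>. \<omega> n)"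
proof -
  define P :: "nat \<Rightarrow> (nat \<Rightarrow> 's) \<Rightarrow> 's measure" where
    "P i \<omega> = measure_pmf (case i of 0 \<Rightarrow> return_pmf s | Suc j \<Rightarrow> K (\<omega> j))" for i \<omega>
  define M :: "nat \<Rightarrow> 's measure" where "M i = count_space UNIV" for i
  have P_meas: "P i \<in> measurable (PiM {0..<i} M) (subprob_algebra (M i))" for i
  proof (cases i)
    case 0
    then have "P i = (\<lambda>_. measure_pmf (return_pmf s))"
      by (simp add: P_def fun_eq_iff)
    then show ?thesis
      by (simp add: M_def measure_pmf_in_subprob_algebra)
  next
    case (Suc j)
    have c: "(\<lambda>\<omega>. \<omega> j) \<in> measurable (PiM {0..<i} M) (count_space UNIV)"
      using measurable_component_singleton[of j "{0..<i}" M] Suc by (simp add: M_def)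
    have "(\<lambda>t. measure_pmf (K t)) \<in> measurable (count_space UNIV) (subprob_algebra (M i))"
      by (simp add: M_def measure_pmf_in_subprob_algebra)
    from measurable_compose[OF c this] show ?thesis
      unfolding P_def[abs_def] Suc by simp
  qed
  interpret IT: Ionescu_Tulcea P M
    by (rule Ionescu_Tulcea.intro[OF P_meas]) (simp add: P_def prob_space_measure_pmf)
  let ?u = "\<lambda>_::nat. undefined :: 's"
  have u: "?u \<in> space (PiM {0..<0} M)"
    by (simp add: space_PiM)
  have sp: "x \<in> space (PiM {0..<n} M) \<longleftrightarrow> x \<in> extensional {0..<n}" for x n
    by (simp add: space_PiM M_def PiE_iff)
  have sing: "{restrict p {0..<n}} \<in> sets (PiM {0..<n} M)" for p n
  proof -
    have "(\<Pi>\<^sub>E i\<in>{0..<n}. {p i}) \<in> sets (PiM {0..<n} M)"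
      by (rule sets_PiM_I_finite) (auto simp: M_def)
    moreover have "(\<Pi>\<^sub>E i\<in>{0..<n}. {p i}) = {restrict p {0..<n}}"
      by (fastforce simp: PiE_iff extensional_def restrict_def fun_eq_iff)
    ultimately show ?thesis by simp
  qed
  have C_Suc: "emeasure (IT.C 0 (Suc n) ?u) {restrict p {0..<Suc n}} =
      emeasure (IT.C 0 n ?u) {restrict p {0..<n}} * emeasure (P n p) {p n}" for n p
  proof -
    have eP: "emeasure (IT.eP n x) {restrict p {0..<Suc n}} =
        emeasure (P n p) {p n} * indicator {restrict p {0..<n}} x"
      if x: "x \<in> space (PiM {0..<n} M)" for x
    proof -
      have "x(n := y) = restrict p {0..<Suc n} \<longleftrightarrow> x = restrict p {0..<n} \<and> y = p n" for y
      proof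
        assume *: "x(n := y) = restrict p {0..<Suc n}"
        have "x i = restrict p {0..<n} i" for i
          using fun_cong[OF *, of i] x sp[of x n] by (auto simp: extensional_def split: if_splits)
        moreover have "y = p n" using fun_cong[OF *, of n] by simp
        ultimately show "x = restrict p {0..<n} \<and> y = p n" by auto
      qed (auto simp: fun_eq_iff)
      then have eq: "(\<lambda>y. x(n := y)) -` {restrict p {0..<Suc n}} \<inter> space (M n) =
          (if x = restrict p {0..<n} then {p n} else {})"
        by (auto simp: M_def)
      have "P n (restrict p {0..<n}) = P n p"
        by (simp add: P_def split: nat.split)
      then show ?thesis
        by (simp only: IT.emeasure_eP[OF x sing] eq) (simp add: indicator_def)
    qed
    have ne: "space (IT.C 0 n ?u) \<noteq> {}"
      using prob_space.not_empty[OF IT.prob_space_C[OF u]] .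
    have eq_sets: "sets (IT.C 0 n ?u) = sets (PiM {0..<n} M)"
      using IT.sets_C[OF u, of n] by simp
    have m: "IT.eP n \<in> measurable (IT.C 0 n ?u) (subprob_algebra (PiM {0..<Suc n} M))"
      using IT.measurable_eP[of n] measurable_cong_sets[OF eq_sets refl] by blast
    have "emeasure (IT.C 0 (Suc n) ?u) {restrict p {0..<Suc n}} =
        (\<integral>\<^sup>+x. emeasure (IT.eP n x) {restrict p {0..<Suc n}} \<partial>IT.C 0 n ?u)"
      using emeasure_bind[OF ne m sing] by simp
    also have "\<dots> = (\<integral>\<^sup>+x. emeasure (P n p) {p n} * indicator {restrict p {0..<n}} x \<partial>IT.C 0 n ?u)"
      by (rule nn_integral_cong) (simp add: eP sets_eq_imp_space_eq[OF eq_sets])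
    also have "\<dots> = emeasure (P n p) {p n} * emeasure (IT.C 0 n ?u) {restrict p {0..<n}}"
      by (rule nn_integral_cmult_indicator) (simp add: eq_sets sing)
    finally show ?thesis by (simp add: mult.commute)
  qed
  have sets_lim: "sets IT.PF.lim = sets (PiM UNIV M)"
    by (rule IT.PF.sets_lim)
  have space_lim: "space IT.PF.lim = UNIV"
    using sets_eq_imp_space_eq[OF sets_lim] by (simp add: space_PiM M_def PiE_def)
  have cyl: "emeasure IT.PF.lim {\<omega> \<in> space IT.PF.lim. \<forall>i<n. \<omega> i = p i} =
      emeasure (IT.C 0 n ?u) {restrict p {0..<n}}" for n p
  proof -
    have "(\<forall>i<n. \<omega> i = p i) \<longleftrightarrow> restrict \<omega> {0..<n} = restrict p {0..<n}" for \<omega>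
      by (auto simp: fun_eq_iff restrict_def)
    then have "{\<omega> \<in> space IT.PF.lim. \<forall>i<n. \<omega> i = p i} =
        IT.PF.emb UNIV {0..<n} {restrict p {0..<n}}"
      by (auto simp: prod_emb_def space_lim M_def space_PiM)
    moreover have "IT.PF.emb {0..<n} {0..<n} {restrict p {0..<n}} = {restrict p {0..<n}}"
      by (rule prod_emb_id) (auto simp: M_def)
    ultimately show ?thesis
      using IT.lim[OF _ sing] IT.emeasure_CI[OF order_refl sing] by simp
  qed
  have cyl_Suc: "emeasure IT.PF.lim {\<omega> \<in> space IT.PF.lim. \<forall>i<Suc n. \<omega> i = p i} =
      emeasure IT.PF.lim {\<omega> \<in> space IT.PF.lim. \<forall>i<n. \<omega> i = p i} * emeasure (P n p) {p n}" for n p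
    by (simp only: cyl C_Suc)
  have prob: "prob_space IT.PF.lim"
  proof
    show "emeasure IT.PF.lim (space IT.PF.lim) = 1"
      using cyl[of 0 ?u] by (simp add: PiM_empty restrict_def)
  qed
  interpret L: prob_space "IT.PF.lim" by (rule prob)
  have step: "measure IT.PF.lim {\<omega> \<in> space IT.PF.lim. (\<forall>i\<le>n. \<omega> i = path i) \<and> \<omega> (Suc n) = t} =
      measure IT.PF.lim {\<omega> \<in> space IT.PF.lim. \<forall>i\<le>n. \<omega> i = path i} * pmf (K (path n)) t" for n path t
  proof -
    define p where "p = path(Suc n := t)"
    have 1: "{\<omega> \<in> space IT.PF.lim. (\<forall>i\<le>n. \<omega> i = path i) \<and> \<omega> (Suc n) = t} =
        {\<omega> \<in> space IT.PF.lim. \<forall>i<Suc (Suc n). \<omega> i = p i}"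
      by (auto simp: p_def less_Suc_eq_le le_Suc_eq)
    have 2: "{\<omega> \<in> space IT.PF.lim. \<forall>i\<le>n. \<omega> i = path i} =
        {\<omega> \<in> space IT.PF.lim. \<forall>i<Suc n. \<omega> i = p i}"
      by (auto simp: p_def less_Suc_eq_le)
    have 3: "emeasure (P (Suc n) p) {p (Suc n)} = ennreal (pmf (K (path n)) t)"
      by (simp add: P_def p_def emeasure_pmf_single)
    show ?thesis
      unfolding 1 2 measure_def cyl_Suc[of "Suc n"] 3 by (simp add: enn2real_mult)
  qed
  have comp: "(\<lambda>\<omega>. \<omega> n) \<in> measurable IT.PF.lim (count_space UNIV)" for n
    using measurable_component_singleton[of n UNIV M]
    by (simp add: M_def measurable_cong_sets[OF sets_lim refl])
  have "emeasure IT.PF.lim {\<omega> \<in> space IT.PF.lim. \<omega> 0 = s} = 1"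
    using cyl_Suc[of 0 "\<lambda>_. s"] L.emeasure_space_1
    by (simp add: P_def emeasure_pmf_single)
  moreover have "{\<omega> \<in> space IT.PF.lim. \<omega> 0 = s} \<in> sets IT.PF.lim"
    using measurable_sets[OF comp[of 0], of "{s}"] by (simp add: vimage_def Int_def conj_commute)
  ultimately have "AE \<omega> in IT.PF.lim. \<omega> 0 = s"
    by (intro L.AE_I_eq_1)
  with prob comp step have "markov_chain K s IT.PF.lim (\<lambda>n \<omega>. \<omega> n)"
    unfolding markov_chain_def by blast
  then show ?thesis by blast
qed

end

(*
  The amounts moved by best responses are sums and differences of quotas, capacities and current
  values, so with a common denominator only finitely many allocations are reachable, and it suffices
  that a stable allocation is reachable from each of them: then the mass q n y at a transient state y
  tends to 0, by induction on the distance from y to the absorbing states.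

  Only jobs with a blocking edge better than some edge they use move first. Each such move decreases,
  lexicographically, the number of edges at least as good as the worst used edge of a job, then the
  amount on these worst edges, or else increases the weighted satisfaction of the machines. When no such
  job is left, every blocking edge uses free quota of its job; best responses preserve this and now
  only machines reject anything, so their satisfaction increases strictly with every move.
*)
theory Submission
  imports Defs
begin

section \<open>Almost sure absorption of Markov chains in finite closed sets\<close>

lemma (in finite_measure) measure_finite_fibres:
  assumes "finite F" and "\<And>y. y \<in> F \<Longrightarrow> {\<omega> \<in> space M. P \<omega> \<and> f \<omega> = y} \<in> sets M"
  shows "measure M {\<omega> \<in> space M. P \<omega> \<and> f \<omega> \<in> F} =
    (\<Sum>y\<in>F. measure M {\<omega> \<in> space M. P \<omega> \<and> f \<omega> = y})"
proof -
  have "{\<omega> \<in> space M. P \<omega> \<and> f \<omega> \<in> F} = (\<Union>y\<in>F. {\<omega> \<in> space M. P \<omega> \<and> f \<omega> = y})"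
    by auto
  then show ?thesis
    using finite_measure_finite_Union[OF assms(1), of "\<lambda>y. {\<omega> \<in> space M. P \<omega> \<and> f \<omega> = y}"] assms(2)
    by (auto simp: disjoint_family_on_def)
qed

text \<open>The absorbed mass \<open>U n\<close> is bounded and nondecreasing, so its increments
  tend to 0. Up to a positive factor they bound the mass at any state with a direct transition into
  \<open>T\<close>. Going backwards along the paths given by \<open>reach\<close>, the mass at every
  state of \<open>R - T\<close> vanishes in the limit, which leaves 1 for \<open>T\<close>.\<close>

lemma markov_chain_absorbed:
  fixes K :: "'s \<Rightarrow> 's pmf" and \<Omega> :: "'w measure"
  assumes mc: "markov_chain K s \<Omega> X"
    and fin: "finite R" and s: "s \<in> R"
    and closed: "\<And>y. y \<in> R \<Longrightarrow> set_pmf (K y) \<subseteq> R"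
    and absorbing: "\<And>y. y \<in> T \<Longrightarrow> K y = return_pmf y"
    and reach: "\<And>y. y \<in> R \<Longrightarrow> \<exists>t\<in>T. (y, t) \<in> {(a, b). b \<in> set_pmf (K a)}\<^sup>*"
  shows "AE \<omega> in \<Omega>. \<exists>n. X n \<omega> \<in> T"
proof -
  interpret prob_space \<Omega> using mc by (simp add: markov_chain_def)
  have X: "X n \<in> measurable \<Omega> (count_space UNIV)" for n
    using mc by (simp add: markov_chain_def)
  have [measurable]: "Measurable.pred \<Omega> (\<lambda>\<omega>. Q (X n \<omega>))" for Q n
    by (rule measurable_compose[OF X]) simp
  \<comment> \<open>The state space may be uncountable, and the chain stays in \<open>R\<close> only
    almost surely. Restricting to trajectories that have stayed in \<open>R\<close> keeps all sums
    over states and paths finite; \<open>q_sum\<close> shows that no mass is lost.\<close>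
  define W where "W n \<omega> \<longleftrightarrow> (\<forall>i\<le>n. X i \<omega> \<in> R)" for n \<omega>
  have [measurable]: "Measurable.pred \<Omega> (W n)" for n
    unfolding W_def by measurable
  have W_Suc: "W (Suc n) \<omega> \<longleftrightarrow> W n \<omega> \<and> X (Suc n) \<omega> \<in> R" for n \<omega>
    by (auto simp: W_def le_Suc_eq)
  define q where "q n y = prob {\<omega> \<in> space \<Omega>. W n \<omega> \<and> X n \<omega> = y}" for n y
  have step: "prob {\<omega> \<in> space \<Omega>. (W n \<omega> \<and> X (Suc n) \<omega> = t) \<and> X n \<omega> = y} = q n y * pmf (K y) t"
    if "y \<in> R" for n y t
  proof -
    \<comment> \<open>\<open>markov_chain\<close> describes transitions only after a full history,
      so the event is split into the finitely many histories in \<open>R\<close> that end in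
      \<open>y\<close>.\<close>
    define F where "F = {p \<in> PiE {..n} (\<lambda>_. R). p n = y}"
    define f where "f \<omega> = restrict (\<lambda>i. X i \<omega>) {..n}" for \<omega>
    have F: "finite F" unfolding F_def by (simp add: finite_PiE fin)
    have fF: "f \<omega> \<in> F \<longleftrightarrow> W n \<omega> \<and> X n \<omega> = y" for \<omega>
      by (auto simp: F_def f_def W_def)
    have fp: "f \<omega> = p \<longleftrightarrow> (\<forall>i\<le>n. X i \<omega> = p i)" if "p \<in> F" for p \<omega>
    proof
      assume "f \<omega> = p" then show "\<forall>i\<le>n. X i \<omega> = p i" by (auto simp: f_def)
    next
      assume "\<forall>i\<le>n. X i \<omega> = p i"
      then have "f \<omega> = restrict p {..n}" unfolding f_def by (intro restrict_ext) auto
      also have "\<dots> = p" using that unfolding F_def by (intro PiE_restrict) auto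
      finally show "f \<omega> = p" .
    qed
    have "prob {\<omega> \<in> space \<Omega>. (W n \<omega> \<and> X (Suc n) \<omega> = t) \<and> X n \<omega> = y} =
        prob {\<omega> \<in> space \<Omega>. X (Suc n) \<omega> = t \<and> f \<omega> \<in> F}"
      by (simp add: fF conj_ac)
    also have "\<dots> = (\<Sum>p\<in>F. prob {\<omega> \<in> space \<Omega>. X (Suc n) \<omega> = t \<and> f \<omega> = p})"
      by (rule measure_finite_fibres[OF F]) (simp add: fp)
    also have "\<dots> = (\<Sum>p\<in>F. prob {\<omega> \<in> space \<Omega>. True \<and> f \<omega> = p} * pmf (K y) t)"
    proof (rule sum.cong[OF refl])
      fix p assume p: "p \<in> F"
      then have "p n = y" by (simp add: F_def)
      with p show "prob {\<omega> \<in> space \<Omega>. X (Suc n) \<omega> = t \<and> f \<omega> = p} =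
          prob {\<omega> \<in> space \<Omega>. True \<and> f \<omega> = p} * pmf (K y) t"
        using mc by (simp add: markov_chain_def fp conj_commute)
    qed
    also have "\<dots> = prob {\<omega> \<in> space \<Omega>. True \<and> f \<omega> \<in> F} * pmf (K y) t"
      by (subst measure_finite_fibres[OF F]) (simp_all add: fp sum_distrib_right)
    finally show ?thesis by (simp add: q_def fF)
  qed
  have q_Suc: "q (Suc n) t = (\<Sum>y\<in>R. q n y * pmf (K y) t)" if "t \<in> R" for n t
  proof -
    have "q (Suc n) t = prob {\<omega> \<in> space \<Omega>. (W n \<omega> \<and> X (Suc n) \<omega> = t) \<and> X n \<omega> \<in> R}"
      unfolding q_def W_Suc using that by (intro arg_cong[of _ _ prob]) (auto simp: W_def)
    also have "\<dots> = (\<Sum>y\<in>R. prob {\<omega> \<in> space \<Omega>. (W n \<omega> \<and> X (Suc n) \<omega> = t) \<and> X n \<omega> = y})"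
      by (rule measure_finite_fibres[OF fin]) simp
    also have "\<dots> = (\<Sum>y\<in>R. q n y * pmf (K y) t)"
      by (rule sum.cong[OF refl step])
    finally show ?thesis .
  qed
  have q_nonneg: "0 \<le> q n y" for n y by (simp add: q_def)
  have K_sum: "(\<Sum>t\<in>R. pmf (K y) t) = 1" if "y \<in> R" for y
    by (rule sum_pmf_eq_1[OF fin closed[OF that]])
  have q_sum: "(\<Sum>y\<in>R. q n y) = 1" for n
  proof (induction n)
    case 0
    have "(\<Sum>y\<in>R. q 0 y) = prob {\<omega> \<in> space \<Omega>. W 0 \<omega> \<and> X 0 \<omega> \<in> R}"
      unfolding q_def by (rule measure_finite_fibres[OF fin, symmetric]) simp
    also have "\<dots> = 1"
    proof (rule prob_eq_1[THEN iffD2])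
      have "AE \<omega> in \<Omega>. X 0 \<omega> = s" using mc by (simp add: markov_chain_def)
      then show "AE \<omega> in \<Omega>. \<omega> \<in> {\<omega> \<in> space \<Omega>. W 0 \<omega> \<and> X 0 \<omega> \<in> R}"
        using AE_space by eventually_elim (auto simp: W_def s)
    qed simp
    finally show ?case .
  next
    case (Suc n)
    have "(\<Sum>t\<in>R. q (Suc n) t) = (\<Sum>t\<in>R. \<Sum>y\<in>R. q n y * pmf (K y) t)"
      by (simp add: q_Suc)
    also have "\<dots> = (\<Sum>y\<in>R. q n y * (\<Sum>t\<in>R. pmf (K y) t))"
      by (subst sum.swap) (simp add: sum_distrib_left)
    finally show ?case by (simp add: K_sum Suc)
  qed
  define U where "U n = (\<Sum>t\<in>R \<inter> T. q n t)" for n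
  have U_step: "U n + q n y * pmf (K y) t \<le> U (Suc n)" if "y \<in> R - T" "t \<in> R \<inter> T" for n y t
  proof -
    \<comment> \<open>Mass at \<open>t'\<close> stays there; for \<open>t' = t\<close> the
      transition from \<open>y\<close>, a state outside \<open>T\<close>, comes on top.\<close>
    have "q n t' + (if t' = t then q n y * pmf (K y) t else 0) \<le> q (Suc n) t'"
      if t': "t' \<in> R \<inter> T" for t'
    proof -
      have "q n t' + (if t' = t then q n y * pmf (K y) t else 0) \<le>
          (\<Sum>z\<in>{t', y}. q n z * pmf (K z) t')"
        using t' \<open>y \<in> R - T\<close> absorbing[of t'] q_nonneg
        by (cases "t' = y") auto
      also have "\<dots> \<le> (\<Sum>z\<in>R. q n z * pmf (K z) t')"
        using t' \<open>y \<in> R - T\<close> fin by (intro sum_mono2) (auto simp: q_nonneg)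
      finally show ?thesis using t' by (simp add: q_Suc)
    qed
    then have "(\<Sum>t'\<in>R \<inter> T. q n t' + (if t' = t then q n y * pmf (K y) t else 0)) \<le> U (Suc n)"
      unfolding U_def by (rule sum_mono)
    then show ?thesis
      using that(2) fin by (simp add: sum.distrib U_def)
  qed
  have U_mono: "U n \<le> U (Suc n)" for n
    unfolding U_def
  proof (rule sum_mono)
    fix t assume t: "t \<in> R \<inter> T"
    have "q n t * pmf (K t) t \<le> (\<Sum>z\<in>R. q n z * pmf (K z) t)"
      using t fin by (intro member_le_sum) (auto simp: q_nonneg)
    then show "q n t \<le> q (Suc n) t"
      using t absorbing[of t] by (simp add: q_Suc)
  qed
  have U_le: "U n \<le> 1" for n
    unfolding U_def q_sum[of n, symmetric] by (intro sum_mono2) (auto simp: fin q_nonneg)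
  have "convergent U"
  proof (rule Bseq_monoseq_convergent)
    have "0 \<le> U n" for n unfolding U_def by (intro sum_nonneg q_nonneg)
    then show "Bseq U" using U_le by (intro BseqI'[of _ 1]) auto
    show "monoseq U" using U_mono by (simp add: monoseq_Suc)
  qed
  then obtain u where u: "U \<longlonglongrightarrow> u" by (auto simp: convergent_def)
  have U_diff: "(\<lambda>n. U (Suc n) - U n) \<longlonglongrightarrow> 0"
    using tendsto_diff[OF LIMSEQ_Suc[OF u] u] by simp
  \<comment> \<open>The factor \<open>pmf (K y) z\<close> is positive and independent of
    \<open>n\<close>, so a null sequence bounding the flow from \<open>y\<close> to \<open>z\<close>
    also forces the mass at \<open>y\<close> to 0.\<close>
  have scale: "(\<lambda>n. q n y) \<longlonglongrightarrow> 0"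
    if le: "\<And>n. q n y * pmf (K y) z \<le> g n" and g: "g \<longlonglongrightarrow> 0" and z: "z \<in> set_pmf (K y)" for y z g
  proof (rule tendsto_sandwich[OF _ _ tendsto_const])
    have pos: "pmf (K y) z > 0" using z by (simp add: pmf_positive)
    show "\<forall>\<^sub>F n in sequentially. q n y \<le> g n / pmf (K y) z"
      using le pos by (simp add: field_simps)
    show "(\<lambda>n. g n / pmf (K y) z) \<longlonglongrightarrow> 0"
      using tendsto_divide[OF g tendsto_const] pos by fastforce
  qed (simp add: q_nonneg)
  have vanish: "(\<lambda>n. q n y) \<longlonglongrightarrow> 0" if y: "y \<in> R - T" for y
  proof -
    obtain t where t: "t \<in> T" "(y, t) \<in> {(a, b). b \<in> set_pmf (K a)}\<^sup>*"
      using reach y by blast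
    \<comment> \<open>Induction backwards from \<open>t\<close>. If the successor \<open>z\<close>
      of \<open>y\<close> is absorbing, the increments of \<open>U\<close> bound the flow into it;
      otherwise its own mass at the next time does.\<close>
    from t(2) y show ?thesis
    proof (induction rule: converse_rtrancl_induct)
      case base
      with t(1) show ?case by simp
    next
      case (step y z)
      then have z: "z \<in> set_pmf (K y)" "z \<in> R" using closed by auto
      show ?case
      proof (cases "z \<in> T")
        case True
        have "q n y * pmf (K y) z \<le> U (Suc n) - U n" for n
          using U_step[of y z n] step.prems z(2) True by simp
        then show ?thesis using U_diff z(1) by (rule scale)
      next
        case False
        have "q n y * pmf (K y) z \<le> q (Suc n) z" for n
          unfolding q_Suc[OF z(2)]
          using step.prems fin by (intro member_le_sum) (auto simp: q_nonneg)
        moreover have "(\<lambda>n. q (Suc n) z) \<longlonglongrightarrow> 0"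
          using step.IH False z(2) by (intro LIMSEQ_Suc) simp
        ultimately show ?thesis using z(1) by (rule scale)
      qed
    qed
  qed
  have U_eq: "U n = 1 - (\<Sum>y\<in>R - T. q n y)" for n
    using sum.Int_Diff[OF fin, of "q n" T] by (simp add: U_def q_sum)
  have "(\<lambda>n. \<Sum>y\<in>R - T. q n y) \<longlonglongrightarrow> 0"
    using tendsto_sum[of "R - T" "\<lambda>y n. q n y" "\<lambda>_. 0"] vanish by simp
  then have "U \<longlonglongrightarrow> 1"
    unfolding U_eq[abs_def] using tendsto_diff[OF tendsto_const] by fastforce
  moreover have "U n \<le> prob {\<omega> \<in> space \<Omega>. \<exists>n. X n \<omega> \<in> T}" for n
  proof -
    have "U n = prob {\<omega> \<in> space \<Omega>. W n \<omega> \<and> X n \<omega> \<in> R \<inter> T}"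
      unfolding U_def q_def by (rule measure_finite_fibres[symmetric]) (simp_all add: fin)
    also have "\<dots> \<le> prob {\<omega> \<in> space \<Omega>. \<exists>n. X n \<omega> \<in> T}"
      by (rule finite_measure_mono) auto
    finally show ?thesis .
  qed
  ultimately have "1 \<le> prob {\<omega> \<in> space \<Omega>. \<exists>n. X n \<omega> \<in> T}"
    by (intro LIMSEQ_le_const2) auto
  then have "prob {\<omega> \<in> space \<Omega>. \<exists>n. X n \<omega> \<in> T} = 1"
    using prob_le_1 by (intro antisym)
  then have "AE \<omega> in \<Omega>. \<omega> \<in> {\<omega> \<in> space \<Omega>. \<exists>n. X n \<omega> \<in> T}"
    by (subst prob_eq_1[symmetric]) simp_all
  then show ?thesis by eventually_elim simp
qed

section \<open>Giving up allocation along a list of edges\<close>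

lemma (in linorder) sorted_key_list_of_set_strict:
  assumes "inj_on f A" "finite A"
  shows "distinct (sorted_key_list_of_set f A)" "set (sorted_key_list_of_set f A) = A"
    "sorted_wrt (<) (map f (sorted_key_list_of_set f A))"
proof -
  interpret folding_insort_key "(\<le>)" "(<)" A f
    by unfold_locales fact
  show "set (sorted_key_list_of_set f A) = A" "sorted_wrt (<) (map f (sorted_key_list_of_set f A))"
    using assms by simp_all
  show "distinct (sorted_key_list_of_set f A)"
    by (rule distinct_if_distinct_map[OF distinct_sorted_key_list_of_set]) simp
qed

lemma reduce_notin [simp]: "e \<notin> set es \<Longrightarrow> reduce r es x e = x e"
  by (induction r es x rule: reduce.induct) (auto simp: Let_def)

lemma reduce_bounds:
  assumes "distinct es" "0 \<le> r" "\<forall>e\<in>set es. 0 \<le> x e" "e \<in> set es"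
  shows "0 \<le> reduce r es x e \<and> reduce r es x e \<le> x e"
  using assms
proof (induction es arbitrary: r x)
  case (Cons a es)
  define d where "d = min r (x a)"
  have d: "0 \<le> d" "0 \<le> x a - d" using Cons.prems by (auto simp: d_def)
  have red: "reduce r (a # es) x = reduce (r - d) es (x(a := x a - d))"
    by (simp add: Let_def d_def)
  show ?case
  proof (cases "e = a")
    case True
    then show ?thesis using Cons.prems(1) d unfolding red by simp
  next
    case False
    have "0 \<le> reduce (r - d) es (x(a := x a - d)) e \<and>
        reduce (r - d) es (x(a := x a - d)) e \<le> (x(a := x a - d)) e"
      using Cons.prems False d by (intro Cons.IH) (auto simp: d_def)
    then show ?thesis using False unfolding red by simp
  qed
qed simp

lemma reduce_sum:
  assumes "distinct es" "0 \<le> r" "\<forall>e\<in>set es. 0 \<le> x e"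
  shows "(\<Sum>e\<in>set es. reduce r es x e) = (\<Sum>e\<in>set es. x e) - min r (\<Sum>e\<in>set es. x e)"
  using assms
proof (induction es arbitrary: r x)
  case (Cons a es)
  define d where "d = min r (x a)"
  let ?x = "x(a := x a - d)"
  have "(\<Sum>e\<in>set es. ?x e) = (\<Sum>e\<in>set es. x e)"
    using Cons.prems by (intro sum.cong) auto
  moreover have "(\<Sum>e\<in>set es. reduce (r - d) es ?x e) =
      (\<Sum>e\<in>set es. ?x e) - min (r - d) (\<Sum>e\<in>set es. ?x e)"
    using Cons.prems by (intro Cons.IH) (auto simp: d_def)
  moreover have "0 \<le> (\<Sum>e\<in>set es. x e)" using Cons.prems by (intro sum_nonneg) auto
  ultimately show ?case using Cons.prems
    by (simp add: Let_def d_def[symmetric]) (auto simp: d_def min_def)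
qed simp

lemma reduce_zero: "\<forall>e\<in>set es. 0 \<le> x e \<Longrightarrow> reduce 0 es x = x"
  by (induction es arbitrary: x) (auto simp: Let_def)

text \<open>An entry is touched only after all earlier ones have been emptied. Sortedness turns the
  condition \<open>\<not> P f e\<close> into the statement that \<open>e\<close> comes before
  \<open>f\<close> in the list.\<close>

lemma reduce_prefix_zero:
  assumes "distinct es" "0 \<le> r" "\<forall>e\<in>set es. 0 \<le> x e" "sorted_wrt P es"
    and "e \<in> set es" "f \<in> set es" "reduce r es x f < x f" "\<not> P f e" "e \<noteq> f"
  shows "reduce r es x e = 0"
  using assms
proof (induction es arbitrary: r x)
  case (Cons a es)
  define d where "d = min r (x a)"
  let ?x = "x(a := x a - d)"
  have x': "\<forall>e\<in>set es. 0 \<le> ?x e" "0 \<le> r - d"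
    using Cons.prems by (auto simp: d_def)
  have red: "reduce r (a # es) x = reduce (r - d) es ?x"
    by (simp add: Let_def d_def)
  consider "e = a" "f \<in> set es" "f \<noteq> a" | "e \<in> set es" "f \<in> set es" "e \<noteq> a" "f \<noteq> a"
    using Cons.prems by auto
  then show ?case
  proof cases
    case 1
    \<comment> \<open>With nothing left to give up, the tail would be unchanged by
      \<open>reduce_zero\<close>, and \<open>f\<close> would keep its value.\<close>
    have "r - d \<noteq> 0"
      using Cons.prems(7) x'(1) 1 unfolding red by (auto simp: reduce_zero simp del: fun_upd_apply) auto
    then have "d = x a" by (auto simp: d_def min_def split: if_splits)
    then show ?thesis using 1 Cons.prems(1) unfolding red by simp
  next
    case 2
    have "reduce (r - d) es ?x f < ?x f" using 2 Cons.prems(7) unfolding red by simp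
    then show ?thesis
      unfolding red using 2 Cons.prems(1,4,8,9) x' by (intro Cons.IH) (assumption | simp)+
  qed
qed simp

text \<open>The order enters only through \<open>min\<close>, which returns one of its arguments;
  everything else is subtraction.\<close>

lemma reduce_closed:
  assumes "\<And>a b. a \<in> G \<Longrightarrow> b \<in> G \<Longrightarrow> a - b \<in> G" "r \<in> G" "\<forall>e\<in>A. x e \<in> G" "set es \<subseteq> A"
  shows "\<forall>e\<in>A. reduce r es x e \<in> G"
  using assms(2-)
proof (induction es arbitrary: r x)
  case (Cons a es)
  define d where "d = min r (x a)"
  have "d \<in> G" using Cons.prems by (auto simp: min_def d_def)
  then have "\<forall>e\<in>A. reduce (r - d) es (x(a := x a - d)) e \<in> G"
    using Cons.prems assms(1) by (intro Cons.IH) auto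
  then show ?case by (simp add: Let_def d_def)
qed simp

section \<open>Vertices of an instance: wanted edges, available amounts, restored quotas\<close>

definition worst_first :: "'v alloc_instance \<Rightarrow> 'v \<Rightarrow> ('v \<times> 'v) list" where
  "worst_first I v = rev (sorted_key_list_of_set (ranking I v) (incident I v))"

lemma restore_eq:
  "restore I v x = reduce (max 0 (load I x v - quota I v)) (worst_first I v) x"
  by (simp add: restore_def worst_first_def)

text \<open>The invariant of the second phase: a job then wants a blocking edge only because of free
  quota, so its best response rejects nothing at the job.\<close>

definition no_better_blocking :: "'v alloc_instance \<Rightarrow> 'v assignment \<Rightarrow> bool" where
  "no_better_blocking I x \<longleftrightarrow>
     (\<forall>e g. blocks I x e \<longrightarrow> g \<in> incident I (fst e) \<longrightarrow> 0 < x g \<longrightarrow> \<not> dominates I (fst e) e g)"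

locale instance_context =
  fixes I :: "'v alloc_instance"
  assumes inst: "stable_allocation_instance I"
begin

lemma finite_edges: "finite (edges I)"
  using inst finite_subset unfolding stable_allocation_instance_def by blast

lemma finite_incident [simp]: "finite (incident I v)"
  using finite_edges by (simp add: incident_def)

lemma edge_ends:
  assumes "e \<in> edges I"
  shows "fst e \<in> jobs I" "snd e \<in> machines I" "e \<in> incident I (fst e)" "e \<in> incident I (snd e)"
  using assms inst by (auto simp: stable_allocation_instance_def incident_def)

lemma incident_edges: "e \<in> incident I v \<Longrightarrow> e \<in> edges I"
  by (simp add: incident_def)

lemma incident_job: "j \<in> jobs I \<Longrightarrow> incident I j = {e \<in> edges I. fst e = j}"
  using inst by (auto simp: stable_allocation_instance_def incident_def)

lemma incident_machine: "m \<in> machines I \<Longrightarrow> incident I m = {e \<in> edges I. snd e = m}"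
  using inst by (auto simp: stable_allocation_instance_def incident_def)

lemma incident_inter:
  assumes "e \<in> edges I" "f \<in> incident I (fst e)" "f \<in> incident I (snd e)"
  shows "f = e"
  using assms edge_ends by (auto simp: incident_job incident_machine prod_eq_iff)

lemma rank_eq:
  assumes "v \<in> jobs I \<union> machines I" "e \<in> incident I v" "f \<in> incident I v"
    "ranking I v e = ranking I v f"
  shows "e = f"
  using assms inst by (auto simp: stable_allocation_instance_def dest: inj_onD)

lemma load_nonneg: "\<forall>e\<in>edges I. 0 \<le> x e \<Longrightarrow> 0 \<le> load I x v"
  unfolding load_def by (intro sum_nonneg) (auto simp: incident_def)

text \<open>As soon as some edge is used there is a worst used one, and it is dominated by whatever
  dominates some used edge. Later arguments can thus work with any used edge instead of the
  worst.\<close>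

lemma wants_iff:
  "wants I x v e \<longleftrightarrow>
    load I x v < quota I v \<or> (\<exists>g\<in>incident I v. 0 < x g \<and> dominates I v e g)"
proof -
  have "\<exists>f. worst_edge I x v f \<and> dominates I v e f"
    if g: "g \<in> incident I v" "0 < x g" "dominates I v e g" for g
  proof -
    let ?P = "{f \<in> incident I v. 0 < x f}"
    have "?P \<noteq> {}" using g by blast
    then have "Max (ranking I v ` ?P) \<in> ranking I v ` ?P"
      by (intro Max_in) simp_all
    then obtain f where f: "f \<in> ?P" "ranking I v f = Max (ranking I v ` ?P)" by auto
    have le: "ranking I v h \<le> ranking I v f" if "h \<in> ?P" for h
      using that f(2) by simp
    then have "worst_edge I x v f"
      using f(1) by (auto simp: worst_edge_def is_arg_max_linorder)
    moreover have "dominates I v e f"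
      using g le[of g] by (simp add: dominates_def)
    ultimately show ?thesis by blast
  qed
  moreover have "f \<in> incident I v \<and> 0 < x f" if "worst_edge I x v f" for f
    using that by (simp add: worst_edge_def is_arg_max_def)
  ultimately show ?thesis unfolding wants_def by blast
qed

text \<open>Free quota and dominated edges together are what the other edges, \<open>e\<close> among
  them, leave of the quota.\<close>

lemma available_eq:
  "available I x v e = quota I v - (\<Sum>f | f \<in> incident I v \<and> \<not> dominates I v e f. x f)"
proof -
  have "load I x v = (\<Sum>f | f \<in> incident I v \<and> dominates I v e f. x f) +
      (\<Sum>f | f \<in> incident I v \<and> \<not> dominates I v e f. x f)"
    unfolding load_def by (subst sum.union_disjoint[symmetric]) (auto intro: sum.cong)
  then show ?thesis by (simp add: available_def)
qed

text \<open>Together with the slack in the capacity this makes the amount of a best response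
  positive.\<close>

lemma available_pos:
  assumes x: "allocation I x" and v: "v \<in> jobs I \<union> machines I" and w: "wants I x v e"
  shows "0 < available I x v e"
proof -
  let ?D = "{f \<in> incident I v. dominates I v e f}"
  have nn: "0 \<le> x f" if "f \<in> ?D" for f
    using x that by (auto simp: allocation_def incident_def)
  have le: "load I x v \<le> quota I v" using x v by (simp add: allocation_def)
  show ?thesis
  proof (cases "load I x v < quota I v")
    case True
    moreover have "0 \<le> sum x ?D" using nn by (rule sum_nonneg)
    ultimately show ?thesis by (simp add: available_def)
  next
    case False
    then obtain g where "g \<in> ?D" "0 < x g" using w by (auto simp: wants_iff)
    then have "0 < sum x ?D" using nn by (intro sum_pos2[of _ g]) auto
    then show ?thesis using le by (simp add: available_def)
  qed
qed

context
  fixes v assumes v: "v \<in> jobs I \<union> machines I"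
begin

lemma worst_first_list [simp]:
  shows "distinct (worst_first I v)" "set (worst_first I v) = incident I v"
    and "sorted_wrt (\<lambda>e f. dominates I v f e) (worst_first I v)"
proof -
  have "inj_on (ranking I v) (incident I v)"
    using inst v by (auto simp: stable_allocation_instance_def)
  note * = sorted_key_list_of_set_strict[OF this finite_incident]
  show "distinct (worst_first I v)" "set (worst_first I v) = incident I v"
    "sorted_wrt (\<lambda>e f. dominates I v f e) (worst_first I v)"
    unfolding worst_first_def using * by (simp_all add: sorted_wrt_map sorted_wrt_rev dominates_def)
qed

lemma restore_notin [simp]: "e \<notin> incident I v \<Longrightarrow> restore I v x e = x e"
  by (simp add: restore_eq)

context
  fixes z :: "'v assignment" assumes z: "\<forall>e\<in>edges I. 0 \<le> z e"
begin

lemma z_incident: "\<forall>e\<in>incident I v. 0 \<le> z e"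
  using z by (simp add: incident_def)

lemma restore_bounds: "e \<in> edges I \<Longrightarrow> 0 \<le> restore I v z e \<and> restore I v z e \<le> z e"
proof (cases "e \<in> incident I v")
  case True
  then show ?thesis unfolding restore_eq
    using z_incident by (intro reduce_bounds) simp_all
qed (use z in simp)

text \<open>Quotas are nonnegative, so the excess never exceeds the load and is given up in
  full.\<close>

lemma load_restore: "load I (restore I v z) v = min (load I z v) (quota I v)"
proof -
  have "0 \<le> quota I v" using inst v by (auto simp: stable_allocation_instance_def)
  moreover have "0 \<le> load I z v" using z by (rule load_nonneg)
  moreover have "load I (restore I v z) v =
      load I z v - min (max 0 (load I z v - quota I v)) (load I z v)"
    using reduce_sum[of "worst_first I v" "max 0 (load I z v - quota I v)" z] z_incident
    by (simp add: restore_eq load_def)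
  ultimately show ?thesis by auto
qed

text \<open>A loss needs a positive excess, after which the quota is met exactly; and since the list
  runs from worst to best, everything worse than \<open>f\<close> has been emptied before
  \<open>f\<close> loses.\<close>

lemma restore_decrease:
  assumes f: "f \<in> incident I v" "restore I v z f < z f"
  shows "load I (restore I v z) v = quota I v"
    and "\<And>g. g \<in> incident I v \<Longrightarrow> dominates I v f g \<Longrightarrow> restore I v z g = 0"
proof -
  have "load I (restore I v z) v < load I z v"
    unfolding load_def
  proof (rule sum_strict_mono_ex1)
    show "\<forall>g\<in>incident I v. restore I v z g \<le> z g" using restore_bounds incident_edges by blast
    show "\<exists>g\<in>incident I v. restore I v z g < z g" using f by blast
  qed simp
  then show "load I (restore I v z) v = quota I v" by (simp add: load_restore)
  show "restore I v z g = 0" if "g \<in> incident I v" "dominates I v f g" for g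
    using that f z_incident unfolding restore_eq
    by (intro reduce_prefix_zero[OF _ _ _ worst_first_list(3), of _ _ _ f])
      (auto simp: dominates_def)
qed

text \<open>Were \<open>f\<close> to lose, all edges dominated by \<open>e\<close> would be empty by
  \<open>restore_decrease\<close>. The remaining ones would carry strictly less than the quota,
  although the load has to equal it.\<close>

lemma restore_keep:
  assumes e: "e \<in> incident I v"
    and le: "(\<Sum>f | f \<in> incident I v \<and> \<not> dominates I v e f. z f) \<le> quota I v"
    and f: "f \<in> incident I v" "\<not> dominates I v e f"
  shows "restore I v z f = z f"
proof (rule ccontr)
  assume "restore I v z f \<noteq> z f"
  then have lt: "restore I v z f < z f" using restore_bounds[OF incident_edges[OF f(1)]] by simp
  let ?A = "{f \<in> incident I v. \<not> dominates I v e f}"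
  have "restore I v z g = 0" if "g \<in> incident I v - ?A" for g
    using that f(2) by (intro restore_decrease(2)[OF f(1) lt]) (auto simp: dominates_def)
  then have "load I (restore I v z) v = sum (restore I v z) ?A"
    unfolding load_def by (intro sum.mono_neutral_right) auto
  also have "\<dots> < sum z ?A"
  proof (rule sum_strict_mono_ex1)
    show "\<forall>g\<in>?A. restore I v z g \<le> z g" using restore_bounds incident_edges by blast
    show "\<exists>g\<in>?A. restore I v z g < z g" using f lt by blast
  qed simp
  finally show False using restore_decrease(1)[OF f(1) lt] le by simp
qed

end
end

end

section \<open>Best responses as exchanges along one edge\<close>

text \<open>The interface between best responses and the progress arguments. It hides the amount
  moved and the two restorations, and charges each loss to an end of \<open>e\<close> that has
  filled its quota by rejecting from its worst edge upwards.\<close>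

definition exchange ::
  "'v alloc_instance \<Rightarrow> 'v assignment \<Rightarrow> 'v \<times> 'v \<Rightarrow> 'v assignment \<Rightarrow> bool" where
  "exchange I x e y \<longleftrightarrow>
     e \<in> edges I \<and> x e < y e \<and> allocation I y \<and>
     (\<forall>f\<in>edges I. f \<noteq> e \<longrightarrow> y f \<le> x f) \<and>
     (\<forall>v\<in>{fst e, snd e}. load I x v \<le> load I y v) \<and>
     (\<forall>f\<in>edges I. y f < x f \<longrightarrow> (\<exists>v\<in>{fst e, snd e}. f \<in> incident I v \<and> dominates I v e f \<and>
        load I y v = quota I v \<and> (\<forall>g\<in>incident I v. dominates I v f g \<longrightarrow> y g = 0)))"

lemma sum_increment:
  fixes x :: "'a \<Rightarrow> real"
  assumes "finite S" "e \<in> S"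
  shows "sum (x(e := x e + A)) S = sum x S + A"
proof -
  have "x(e := x e + A) = (\<lambda>f. x f + (if f = e then A else 0))" by auto
  then show ?thesis using assms by (simp add: sum.distrib)
qed

context instance_context
begin

lemma best_blocking_edge:
  assumes "j \<in> blocking_jobs I x"
  defines "e \<equiv> best_blocking_edge I x j"
  shows "blocks I x e" "fst e = j"
    and "\<And>f. f \<in> incident I j \<Longrightarrow> blocks I x f \<Longrightarrow> ranking I j e \<le> ranking I j f"
proof -
  let ?B = "{e \<in> incident I j. blocks I x e}"
  have "?B \<noteq> {}" "j \<in> jobs I" using assms(1) unfolding blocking_jobs_def by blast+
  then have *: "e \<in> ?B" "\<not> (\<exists>f\<in>?B. ranking I j f < ranking I j e)"
    unfolding e_def best_blocking_edge_def by (intro arg_min_if_finite; simp)+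
  then show "blocks I x e" by simp
  show "fst e = j" using * \<open>j \<in> jobs I\<close> by (simp add: incident_job)
  show "ranking I j e \<le> ranking I j f" if "f \<in> incident I j" "blocks I x f" for f
    using *(2) that by (metis (mono_tags, lifting) mem_Collect_eq not_less)
qed

text \<open>The two restorations do not interfere: the ends of \<open>e\<close> share no other edge,
  and \<open>e\<close> keeps its whole gain because the amount is bounded by what is available at
  either end.\<close>

lemma exchange_best_response:
  assumes x: "allocation I x" and j: "j \<in> blocking_jobs I x"
  shows "exchange I x (best_blocking_edge I x j) (best_response I x j)"
proof -
  define e where "e = best_blocking_edge I x j"
  define m where "m = snd e"
  define A where "A = Min {available I x j e, capacity I e - x e, available I x m e}"
  define z1 where "z1 = x(e := x e + A)"
  define z2 where "z2 = restore I j z1"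
  define y where "y = restore I m z2"
  have y_eq: "best_response I x j = y"
    by (simp add: best_response_def Let_def y_def z2_def z1_def A_def m_def e_def)
  have bl: "blocks I x e" and fe: "fst e = j"
    using best_blocking_edge[OF j] by (simp_all add: e_def)
  have e: "e \<in> edges I" "x e < capacity I e" "wants I x j e" "wants I x m e"
    using bl fe by (simp_all add: blocks_def m_def)
  have ends: "j \<in> jobs I" "m \<in> machines I" "e \<in> incident I j" "e \<in> incident I m"
    using edge_ends[OF e(1)] by (simp_all add: fe m_def)
  then have jv: "j \<in> jobs I \<union> machines I" and mv: "m \<in> jobs I \<union> machines I" by simp_all
  have A: "0 < A" "A \<le> available I x j e" "A \<le> capacity I e - x e" "A \<le> available I x m e"
    using available_pos[OF x jv e(3)] available_pos[OF x mv e(4)] e(2) by (auto simp: A_def)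
  have x0: "0 \<le> x f" "x f \<le> capacity I f" if "f \<in> edges I" for f
    using x that by (simp_all add: allocation_def)
  have z1: "\<forall>f\<in>edges I. 0 \<le> z1 f" using x0 A(1) by (simp add: z1_def add_nonneg_nonneg)
  have z1_load: "load I z1 v = load I x v + A" if "v \<in> {j, m}" for v
    using that ends unfolding load_def z1_def by (intro sum_increment) auto
  \<comment> \<open>Since \<open>A\<close> is at most the amount available at either end, the edges
    not dominated by \<open>e\<close> still fit into the quota after the increase, as
    \<open>restore_keep\<close> demands.\<close>
  have z1_top: "(\<Sum>f | f \<in> incident I v \<and> \<not> dominates I v e f. z1 f) \<le> quota I v" if "v \<in> {j, m}" for v
  proof -
    have "(\<Sum>f | f \<in> incident I v \<and> \<not> dominates I v e f. z1 f) =
        (\<Sum>f | f \<in> incident I v \<and> \<not> dominates I v e f. x f) + A"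
      unfolding z1_def using that ends by (intro sum_increment) (auto simp: dominates_def)
    moreover have "A \<le> available I x v e" using that A by auto
    ultimately show ?thesis unfolding available_eq by simp
  qed
  have z2_keep: "z2 f = z1 f" if "f \<notin> incident I j \<or> \<not> dominates I j e f" for f
    using that restore_keep[OF jv z1 ends(3) z1_top, of f] restore_notin[OF jv, of f z1]
    unfolding z2_def by auto
  have meet: "f = e" if "f \<in> incident I j" "f \<in> incident I m" for f
    using incident_inter[OF e(1)] that by (simp add: fe m_def)
  have not_self: "\<not> dominates I v e e" for v by (simp add: dominates_def)
  \<comment> \<open>The restoration at \<open>j\<close> reduces only edges dominated by
    \<open>e\<close> at \<open>j\<close>. None of them meets \<open>m\<close>, as \<open>e\<close>
    is the only common edge.\<close>
  have z2_m: "z2 f = z1 f" if "f \<in> incident I m" for f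
    using that meet[of f] not_self by (intro z2_keep) auto
  have z2: "\<forall>f\<in>edges I. 0 \<le> z2 f"
    unfolding z2_def using restore_bounds[OF jv z1] by blast
  have z2_top: "(\<Sum>f | f \<in> incident I m \<and> \<not> dominates I m e f. z2 f) \<le> quota I m"
    using z1_top[of m] by (simp add: z2_m cong: conj_cong sum.cong_simp)
  have y_keep: "y f = z2 f" if "f \<notin> incident I m \<or> \<not> dominates I m e f" for f
    using that restore_keep[OF mv z2 ends(4) z2_top, of f] restore_notin[OF mv, of f z2]
    unfolding y_def by auto
  have y_j: "y f = z2 f" if "f \<in> incident I j" for f
    using that meet[of f] not_self by (intro y_keep) auto
  have y_nonneg: "0 \<le> y f" "y f \<le> z2 f" if "f \<in> edges I" for f
    unfolding y_def using restore_bounds[OF mv z2 that] by auto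
  have z2_le: "z2 f \<le> z1 f" if "f \<in> edges I" for f
    unfolding z2_def using restore_bounds[OF jv z1 that] by auto
  have ye: "y e = x e + A"
    using y_keep[of e] z2_keep[of e] not_self by (simp add: z1_def)
  have le: "y f \<le> x f" if "f \<in> edges I" "f \<noteq> e" for f
    using y_nonneg(2)[OF that(1)] z2_le[OF that(1)] that(2) by (simp add: z1_def)
  have load_j: "load I y j = min (load I x j + A) (quota I j)"
  proof -
    have "load I y j = load I z2 j" unfolding load_def by (simp add: y_j)
    then show ?thesis using load_restore[OF jv z1] z1_load by (simp add: z2_def)
  qed
  have load_m: "load I y m = min (load I x m + A) (quota I m)"
  proof -
    have "load I z2 m = load I z1 m" unfolding load_def by (simp add: z2_m)
    then show ?thesis using load_restore[OF mv z2] z1_load by (simp add: y_def)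
  qed
  have lx: "load I x v \<le> quota I v" if "v \<in> jobs I \<union> machines I" for v
    using x that by (simp add: allocation_def)
  have "allocation I y"
    unfolding allocation_def
  proof (intro conjI ballI)
    fix f assume f: "f \<in> edges I"
    show "0 \<le> y f" using f by (rule y_nonneg)
    show "y f \<le> capacity I f"
      using le[OF f] x0(2)[OF f] A(3) ye by (cases "f = e") auto
  next
    fix v assume v: "v \<in> jobs I \<union> machines I"
    show "load I y v \<le> quota I v"
    proof (cases "v \<in> {j, m}")
      case False
      have "f \<noteq> e" if "f \<in> incident I v" for f
        using that False fe by (auto simp: incident_def m_def)
      then have "load I y v \<le> load I x v"
        unfolding load_def by (intro sum_mono le) (auto intro: incident_edges)
      then show ?thesis using lx[OF v] by simp
    qed (auto simp: load_j load_m)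
  qed
  moreover have "load I x v \<le> load I y v" if "v \<in> {j, m}" for v
    using that lx[OF jv] lx[OF mv] A(1) by (auto simp: load_j load_m)
  moreover have "\<exists>v\<in>{j, m}. f \<in> incident I v \<and> dominates I v e f \<and>
      load I y v = quota I v \<and> (\<forall>g\<in>incident I v. dominates I v f g \<longrightarrow> y g = 0)"
    if f: "f \<in> edges I" "y f < x f" for f
  proof -
    have fne: "f \<noteq> e" using f(2) ye A(1) by auto
    then have z1f: "z1 f = x f" by (simp add: z1_def)
    \<comment> \<open>The loss is attributed to the restoration that caused it, first at
      \<open>j\<close>, then at \<open>m\<close>.\<close>
    consider "z2 f < z1 f" | "y f < z2 f" "z2 f = z1 f"
      using f z1f z2_le[OF f(1)] by fastforce
    then show ?thesis
    proof cases
      case 1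
      then have fj: "f \<in> incident I j" "dominates I j e f" using z2_keep by fastforce+
      have dec: "restore I j z1 f < z1 f" using 1 by (simp add: z2_def)
      have "load I y j = load I z2 j" unfolding load_def by (simp add: y_j)
      then have "load I y j = quota I j"
        using restore_decrease(1)[OF jv z1 fj(1) dec] by (simp add: z2_def)
      moreover have "y g = 0" if "g \<in> incident I j" "dominates I j f g" for g
        using restore_decrease(2)[OF jv z1 fj(1) dec that] y_j[OF that(1)] by (simp add: z2_def)
      ultimately show ?thesis using fj by blast
    next
      case 2
      then have fm: "f \<in> incident I m" "dominates I m e f" using y_keep by fastforce+
      have "restore I m z2 f < z2 f" using 2 by (simp add: y_def)
      from restore_decrease[OF mv z2 fm(1) this] show ?thesis using fm by (auto simp: y_def)
    qed
  qed
  ultimately have "exchange I x e y"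
    unfolding exchange_def using e(1) ye A(1) le fe by (auto simp: m_def)
  then show ?thesis by (simp add: e_def y_eq)
qed

text \<open>Assignments are total functions; fixing their values off the edge set is part of
  confining the dynamics to a finite set.\<close>

lemma best_response_off_edges:
  assumes "j \<in> blocking_jobs I x" "f \<notin> edges I"
  shows "best_response I x j f = x f"
proof -
  define e where "e = best_blocking_edge I x j"
  have "e \<in> edges I" "fst e = j"
    using best_blocking_edge[OF assms(1)] by (auto simp: e_def blocks_def)
  moreover have "f \<notin> incident I v" for v using assms(2) by (simp add: incident_def)
  ultimately show ?thesis
    using assms(2) edge_ends[of e] by (auto simp: best_response_def Let_def e_def[symmetric])
qed

text \<open>The hypotheses make \<open>G\<close> an additive subgroup, with sums obtained as
  \<open>a - (0 - b)\<close>. A best response only adds, subtracts and takes minima or maxima. The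
  intended \<open>G\<close> is the set of multiples of a fixed unit fraction.\<close>

lemma best_response_closed:
  assumes G: "0 \<in> G" "\<And>a b. a \<in> G \<Longrightarrow> b \<in> G \<Longrightarrow> a - b \<in> G"
    and quota: "\<And>v. v \<in> jobs I \<union> machines I \<Longrightarrow> quota I v \<in> G"
    and capacity: "\<And>e. e \<in> edges I \<Longrightarrow> capacity I e \<in> G"
    and x: "\<forall>e\<in>edges I. x e \<in> G" and j: "j \<in> blocking_jobs I x"
  shows "\<forall>e\<in>edges I. best_response I x j e \<in> G"
proof -
  have add: "a + b \<in> G" if "a \<in> G" "b \<in> G" for a b
    using G(2)[OF that(1) G(2)[OF G(1) that(2)]] by simp
  have sum: "sum z S \<in> G" if "\<forall>e\<in>edges I. z e \<in> G" "S \<subseteq> edges I" for z S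
    using that(2) by (induction S rule: infinite_finite_induct) (auto simp: G(1) that(1) intro: add)
  have restore: "\<forall>e\<in>edges I. restore I v z e \<in> G"
    if z: "\<forall>e\<in>edges I. z e \<in> G" and v: "v \<in> jobs I \<union> machines I" for z v
    unfolding restore_eq
  proof (rule reduce_closed[OF G(2)])
    have "load I z v \<in> G" unfolding load_def using z by (intro sum) (auto simp: incident_def)
    then show "max 0 (load I z v - quota I v) \<in> G" using G quota[OF v] by (simp add: max_def)
    show "set (worst_first I v) \<subseteq> edges I" using v by (auto simp: incident_def)
  qed (use z in auto)
  define e where "e = best_blocking_edge I x j"
  have e: "e \<in> edges I" "fst e = j"
    using best_blocking_edge[OF j] by (auto simp: e_def blocks_def)
  have ends: "j \<in> jobs I \<union> machines I" "snd e \<in> jobs I \<union> machines I"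
    using edge_ends[OF e(1)] e(2) by auto
  have avail: "available I x v e \<in> G" if "v \<in> jobs I \<union> machines I" for v
    unfolding available_eq using x by (intro G(2) quota that sum) (auto simp: incident_def)
  define A where "A = Min {available I x j e, capacity I e - x e, available I x (snd e) e}"
  have "A \<in> G"
    using avail[OF ends(1)] avail[OF ends(2)] G(2)[OF capacity[OF e(1)], of "x e"] x e(1)
    by (simp add: A_def min_def)
  then have "\<forall>f\<in>edges I. (x(e := x e + A)) f \<in> G" using x e(1) add by auto
  from restore[OF restore[OF this ends(1)] ends(2)]
  show ?thesis
    unfolding best_response_def Let_def e_def[symmetric] A_def .
qed

end

section \<open>Three potentials and their progress\<close>

text \<open>The sum of all ranks is at least each single rank, which makes every weight at least 1.
  Ranks are integers, so at one machine a better edge weighs at least 1 more than a worse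
  one.\<close>

definition machine_weight :: "'v alloc_instance \<Rightarrow> 'v \<times> 'v \<Rightarrow> real" where
  "machine_weight I e =
     1 + (\<Sum>f\<in>edges I. real (ranking I (snd f) f)) - real (ranking I (snd e) e)"

definition machine_potential :: "'v alloc_instance \<Rightarrow> 'v assignment \<Rightarrow> real" where
  "machine_potential I x = (\<Sum>e\<in>edges I. x e * machine_weight I e)"

text \<open>Its cardinality measures how bad the worst used edge of \<open>j\<close> is, and it is
  empty when \<open>j\<close> uses nothing.\<close>

definition covered :: "'v alloc_instance \<Rightarrow> 'v assignment \<Rightarrow> 'v \<Rightarrow> ('v \<times> 'v) set" where
  "covered I x j =
     {f \<in> incident I j. \<exists>g\<in>incident I j. 0 < x g \<and> ranking I j f \<le> ranking I j g}"

text \<open>For the covered edges of a job this is the worst used edge as a singleton, or empty for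
  an idle job, so that a sum over it needs no case distinction.\<close>

definition lowest :: "'v alloc_instance \<Rightarrow> 'v \<Rightarrow> ('v \<times> 'v) set \<Rightarrow> ('v \<times> 'v) set" where
  "lowest I j B = {g \<in> B. \<forall>f\<in>B. ranking I j f \<le> ranking I j g}"

definition covered_count :: "'v alloc_instance \<Rightarrow> 'v assignment \<Rightarrow> nat" where
  "covered_count I x = (\<Sum>j\<in>jobs I. card (covered I x j))"

definition lowest_value :: "'v alloc_instance \<Rightarrow> 'v assignment \<Rightarrow> real" where
  "lowest_value I x = (\<Sum>j\<in>jobs I. \<Sum>g\<in>lowest I j (covered I x j). x g)"

text \<open>Minimise \<open>f\<close>, then \<open>g\<close> among the minimisers, then
  \<open>h\<close> among those. The inequality for \<open>g\<close> is requested only in case of a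
  tie in \<open>f\<close>, which is the form in which the progress of a move is known.\<close>

lemma finite_lex_minimum:
  fixes f :: "'a \<Rightarrow> 'b::linorder" and g :: "'a \<Rightarrow> 'c::linorder" and h :: "'a \<Rightarrow> 'd::linorder"
  assumes "finite R" "R \<noteq> {}"
  obtains y where "y \<in> R"
    and "\<And>z. z \<in> R \<Longrightarrow> f z \<le> f y \<Longrightarrow> (f z = f y \<Longrightarrow> g z \<le> g y) \<Longrightarrow> f z = f y \<and> g z = g y \<and> h y \<le> h z"
proof -
  have least: "\<exists>y\<in>S. \<forall>z\<in>S. k y \<le> k z" if "finite S" "S \<noteq> {}" for S and k :: "'a \<Rightarrow> 'e::linorder"
    using arg_min_if_finite(1)[OF that, of k] arg_min_least[OF that, of _ k] by blast
  define S where "S = {y \<in> R. \<forall>z\<in>R. f y \<le> f z}"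
  define T where "T = {y \<in> S. \<forall>z\<in>S. g y \<le> g z}"
  have S: "finite S" "S \<noteq> {}" using least[OF assms, of f] assms(1) by (auto simp: S_def)
  then have T: "finite T" "T \<noteq> {}" using least[OF S, of g] by (auto simp: T_def)
  obtain y where y: "y \<in> T" "\<forall>z\<in>T. h y \<le> h z" using least[OF T, of h] by blast
  then have yS: "y \<in> S" and yR: "y \<in> R" by (simp_all add: T_def S_def)
  show thesis
  proof (rule that[OF yR])
    fix z assume z: "z \<in> R" "f z \<le> f y" and gz: "f z = f y \<Longrightarrow> g z \<le> g y"
    have fz: "f z = f y" using z yS by (auto simp: S_def intro: antisym)
    then have zS: "z \<in> S" using z(1) yS by (simp add: S_def)
    have "g z = g y" using gz[OF fz] zS y(1) by (auto simp: T_def intro: antisym)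
    moreover from this have "z \<in> T" using zS y(1) by (simp add: T_def)
    ultimately show "f z = f y \<and> g z = g y \<and> h y \<le> h z" using fz y(2) by simp
  qed
qed

context instance_context
begin

lemma exchangeD:
  assumes "exchange I x e y"
  shows "e \<in> edges I" "x e < y e" "allocation I y"
    and "\<And>f. f \<in> edges I \<Longrightarrow> f \<noteq> e \<Longrightarrow> y f \<le> x f"
    and "load I x (fst e) \<le> load I y (fst e)" "load I x (snd e) \<le> load I y (snd e)"
  using assms by (auto simp: exchange_def)

lemma exchange_loss:
  assumes "exchange I x e y" "f \<in> edges I" "y f < x f"
  obtains v where "v = fst e \<or> v = snd e" "f \<in> incident I v" "dominates I v e f"
    "load I y v = quota I v" "\<And>g. g \<in> incident I v \<Longrightarrow> dominates I v f g \<Longrightarrow> y g = 0"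
proof -
  have "\<exists>v\<in>{fst e, snd e}. f \<in> incident I v \<and> dominates I v e f \<and>
      load I y v = quota I v \<and> (\<forall>g\<in>incident I v. dominates I v f g \<longrightarrow> y g = 0)"
    using assms unfolding exchange_def by blast
  then show thesis using that by blast
qed

text \<open>An edge other than \<open>e\<close> at the machine of \<open>e\<close> does not meet the
  job of \<open>e\<close>, so the end charged with the loss is the machine.\<close>

lemma exchange_machine_loss:
  assumes ex: "exchange I x e y" and f: "f \<in> edges I" "y f < x f" and m: "snd f = snd e"
  shows "dominates I (snd e) e f" "load I y (snd e) = quota I (snd e)"
    and "\<And>g. g \<in> incident I (snd e) \<Longrightarrow> dominates I (snd e) f g \<Longrightarrow> y g = 0"
proof -
  note e = exchangeD(1)[OF ex]
  obtain v where v: "v = fst e \<or> v = snd e" "f \<in> incident I v" "dominates I v e f"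
    "load I y v = quota I v" "\<And>g. g \<in> incident I v \<Longrightarrow> dominates I v f g \<Longrightarrow> y g = 0"
    using exchange_loss[OF ex f] by blast
  have "f \<noteq> e" using f(2) exchangeD(2)[OF ex] by auto
  moreover have "f \<in> incident I (snd e)" using edge_ends(4)[OF f(1)] m by simp
  ultimately have "v = snd e" using incident_inter[OF e] v(1,2) by blast
  then show "dominates I (snd e) e f" "load I y (snd e) = quota I (snd e)"
    "\<And>g. g \<in> incident I (snd e) \<Longrightarrow> dominates I (snd e) f g \<Longrightarrow> y g = 0"
    using v by auto
qed

lemma machine_weight_ge_1: "e \<in> edges I \<Longrightarrow> 1 \<le> machine_weight I e"
  using member_le_sum[of e "edges I" "\<lambda>f. real (ranking I (snd f) f)"] finite_edges
  by (simp add: machine_weight_def)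

text \<open>At the machine of \<open>e\<close> each unit lost is lost to \<open>e\<close>, which
  weighs at least 1 more, and the load does not fall. No other machine changes.\<close>

lemma machine_potential_increases:
  assumes ex: "exchange I x e y" and loss: "\<And>f. f \<in> edges I \<Longrightarrow> y f < x f \<Longrightarrow> snd f = snd e"
  shows "machine_potential I x < machine_potential I y"
proof -
  let ?m = "snd e" and ?w = "machine_weight I"
  note e = exchangeD(1)[OF ex]
  have ends: "?m \<in> machines I" "e \<in> incident I ?m" using edge_ends[OF e] by auto
  have sub: "incident I ?m \<subseteq> edges I" by (auto simp: incident_def)
  have "0 < y e - x e" using exchangeD(2)[OF ex] by simp
  \<comment> \<open>The reference weight \<open>?w e - 1\<close> is nonnegative and at least the
    weight of every losing edge; the gain at \<open>e\<close> is worth 1 more per unit, which is the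
    last summand.\<close>
  also have "\<dots> \<le> (load I y ?m - load I x ?m) * (?w e - 1) + (y e - x e)"
    using exchangeD(6)[OF ex] machine_weight_ge_1[OF e] by simp
  also have "\<dots> = (\<Sum>f\<in>incident I ?m. (y f - x f) * (?w e - 1) + (if f = e then y e - x e else 0))"
    using ends by (simp add: load_def sum.distrib sum_subtractf sum_distrib_right[symmetric])
  also have "\<dots> \<le> (\<Sum>f\<in>incident I ?m. (y f - x f) * ?w f)"
  proof (rule sum_mono)
    fix f assume f: "f \<in> incident I ?m"
    then have fE: "f \<in> edges I" "snd f = ?m"
      using ends(1) by (simp_all add: incident_machine)
    show "(y f - x f) * (?w e - 1) + (if f = e then y e - x e else 0) \<le> (y f - x f) * ?w f"
    proof (cases "f = e")
      case True
      then show ?thesis by (simp add: algebra_simps)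
    next
      case False
      then consider "y f = x f" | "y f < x f" using exchangeD(4)[OF ex fE(1)] by fastforce
      then show ?thesis
      proof cases
        case 2
        then have "ranking I ?m e < ranking I ?m f"
          using exchange_machine_loss(1)[OF ex fE(1) _ fE(2)] by (simp add: dominates_def)
        then have "?w f \<le> ?w e - 1" by (simp add: machine_weight_def fE(2))
        then show ?thesis using 2 False by (simp add: mult_left_mono_neg)
      qed (use False in simp)
    qed
  qed
  also have "\<dots> = (\<Sum>f\<in>edges I. (y f - x f) * ?w f)"
  proof (rule sum.mono_neutral_left[OF finite_edges sub], rule ballI)
    fix f assume f: "f \<in> edges I - incident I ?m"
    then have "snd f \<noteq> ?m" "f \<noteq> e" using ends by (auto simp: incident_machine)
    then have "y f = x f" using f loss[of f] exchangeD(4)[OF ex, of f] by fastforce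
    then show "(y f - x f) * ?w f = 0" by simp
  qed
  finally show ?thesis
    by (simp add: machine_potential_def left_diff_distrib sum_subtractf)
qed

lemma finite_covered [simp]: "finite (covered I x j)"
  by (simp add: covered_def)

lemma lowest_exists:
  assumes "f \<in> covered I x j"
  obtains g where "g \<in> lowest I j (covered I x j)"
proof -
  let ?B = "covered I x j"
  have "Max (ranking I j ` ?B) \<in> ranking I j ` ?B"
    using assms by (intro Max_in) auto
  then obtain g where "g \<in> ?B" "ranking I j g = Max (ranking I j ` ?B)" by auto
  then have "g \<in> lowest I j ?B" by (simp add: lowest_def)
  then show thesis by (rule that)
qed

text \<open>A covered edge is at least as good as some used edge, and that one is covered too; for a
  lowest edge the ranks agree, so the two coincide.\<close>

lemma lowest_pos:
  assumes "g \<in> lowest I j (covered I x j)" "j \<in> jobs I"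
  shows "0 < x g"
proof -
  obtain h where h: "h \<in> incident I j" "0 < x h" "ranking I j g \<le> ranking I j h"
    and g: "g \<in> incident I j"
    using assms(1) by (auto simp: lowest_def covered_def)
  then have "h \<in> covered I x j" by (auto simp: covered_def)
  then have "ranking I j h \<le> ranking I j g" using assms(1) by (simp add: lowest_def)
  then have "g = h" using h g assms(2) by (intro rank_eq[of j]) auto
  then show ?thesis using h by simp
qed

text \<open>
  Covered edges of a job never become more, since a rejection can only remove the worst edge in
  use and the new edge \<open>e\<close> beats an edge in use. As long as they stay the same, the worst edges in
  use are fixed and never gain; once their values are constant as well, the job loses nothing
  (its losses start at its worst edge), so only the machine of \<open>e\<close> changes, for the better.
\<close>

lemma exchange_better_progress:
  assumes ex: "exchange I x e y"
    and g: "g \<in> incident I (fst e)" "0 < x g" "dominates I (fst e) e g"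
  shows "covered_count I y \<le> covered_count I x"
    and "covered_count I y = covered_count I x \<Longrightarrow> lowest_value I y \<le> lowest_value I x"
    and "covered_count I y = covered_count I x \<Longrightarrow> lowest_value I y = lowest_value I x \<Longrightarrow>
      machine_potential I x < machine_potential I y"
proof -
  note e = exchangeD(1)[OF ex]
  have fin: "finite (jobs I)" using inst by (simp add: stable_allocation_instance_def)
  have sub: "covered I y j \<subseteq> covered I x j" if j: "j \<in> jobs I" for j
  proof
    fix f assume "f \<in> covered I y j"
    then obtain h where f: "f \<in> incident I j" and h: "h \<in> incident I j" "0 < y h"
        "ranking I j f \<le> ranking I j h"
      by (auto simp: covered_def)
    show "f \<in> covered I x j"
    proof (cases "h = e")
      case True
      then have "fst e = j" using h(1) j by (simp add: incident_job)
      then have "ranking I j f \<le> ranking I j g"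
        using g(3) h(3) True by (simp add: dominates_def)
      then show ?thesis using f g \<open>fst e = j\<close> by (auto simp: covered_def)
    next
      case False
      then have "0 < x h" using h(2) exchangeD(4)[OF ex incident_edges[OF h(1)]] by simp
      then show ?thesis using f h by (auto simp: covered_def)
    qed
  qed
  have card_le: "card (covered I y j) \<le> card (covered I x j)" if "j \<in> jobs I" for j
    by (rule card_mono[OF finite_covered sub[OF that]])
  then show "covered_count I y \<le> covered_count I x"
    unfolding covered_count_def by (rule sum_mono)
  assume cc: "covered_count I y = covered_count I x"
  have cov: "covered I y j = covered I x j" if "j \<in> jobs I" for j
  proof -
    have "card (covered I y j) = card (covered I x j)"
      by (rule sum_mono_inv[OF cc[unfolded covered_count_def] card_le that fin])
    then show ?thesis by (rule card_subset_eq[OF finite_covered sub[OF that]])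
  qed
  \<comment> \<open>The edge \<open>e\<close> is strictly better than the covered edge
    \<open>g\<close>, so its gain never enters \<open>lowest_value\<close>.\<close>
  have not_e: "f \<noteq> e" if "f \<in> lowest I j (covered I x j)" "j \<in> jobs I" for f j
  proof
    assume "f = e"
    moreover have "f \<in> incident I j" using that by (simp add: lowest_def covered_def)
    ultimately have "fst e = j" using that(2) by (simp add: incident_job)
    then have "g \<in> covered I x j" using g by (auto simp: covered_def)
    then show False
      using that(1) g(3) \<open>f = e\<close> \<open>fst e = j\<close> by (auto simp: lowest_def dominates_def)
  qed
  have low_edge: "f \<in> edges I" if "f \<in> lowest I j (covered I x j)" for f j
    using that incident_edges[of f j] by (simp add: lowest_def covered_def)
  have low_le: "(\<Sum>f\<in>lowest I j (covered I y j). y f) \<le> (\<Sum>f\<in>lowest I j (covered I x j). x f)"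
    if "j \<in> jobs I" for j
    unfolding cov[OF that] using that
    by (intro sum_mono exchangeD(4)[OF ex] low_edge not_e)
  then show "lowest_value I y \<le> lowest_value I x"
    unfolding lowest_value_def by (rule sum_mono)
  assume lv: "lowest_value I y = lowest_value I x"
  have low_eq: "y f = x f" if j: "j \<in> jobs I" and f: "f \<in> lowest I j (covered I x j)" for f j
  proof (rule sum_mono_inv[OF _ _ f])
    show "(\<Sum>f\<in>lowest I j (covered I x j). y f) = (\<Sum>f\<in>lowest I j (covered I x j). x f)"
      using sum_mono_inv[OF lv[unfolded lowest_value_def] low_le j fin] cov[OF j] by simp
    show "y i \<le> x i" if "i \<in> lowest I j (covered I x j)" for i
      using that j by (intro exchangeD(4)[OF ex] low_edge not_e)
    show "finite (lowest I j (covered I x j))" by (simp add: lowest_def)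
  qed
  show "machine_potential I x < machine_potential I y"
  proof (rule machine_potential_increases[OF ex])
    fix f assume f: "f \<in> edges I" "y f < x f"
    show "snd f = snd e"
    proof (rule ccontr)
      assume ne: "snd f \<noteq> snd e"
      let ?j = "fst e"
      have j: "?j \<in> jobs I" using edge_ends[OF e] by simp
      obtain v where v: "v = fst e \<or> v = snd e" "f \<in> incident I v"
        "\<And>g. g \<in> incident I v \<Longrightarrow> dominates I v f g \<Longrightarrow> y g = 0"
        using exchange_loss[OF ex f] by blast
      have "v \<noteq> snd e" using v(2) ne edge_ends[OF e] by (auto simp: incident_machine)
      then have vj: "v = ?j" using v(1) by simp
      have "0 \<le> y f" using exchangeD(3)[OF ex] f(1) by (simp add: allocation_def)
      then have fc: "f \<in> covered I x ?j" using f(2) v(2) vj by (auto simp: covered_def intro!: bexI[of _ f])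
      then obtain h where h: "h \<in> lowest I ?j (covered I x ?j)" by (rule lowest_exists)
      then have hi: "h \<in> incident I ?j" "ranking I ?j f \<le> ranking I ?j h"
        using fc by (simp_all add: lowest_def) (simp add: covered_def)
      \<comment> \<open>\<open>lowest_pos\<close> is applied to \<open>y\<close>, which has the same
        covered edges: the worst edge is still in use, so no better edge of the job can have been
        reduced.\<close>
      have yh: "0 < y h" "y h = x h"
        using lowest_pos[of h ?j y] h cov[OF j] j low_eq[OF j h] by simp_all
      then have "f \<noteq> h" using f(2) by auto
      then have "dominates I ?j f h"
        using rank_eq[of ?j f h] hi v(2) vj j by (auto simp: dominates_def le_less)
      then show False using v(3) vj hi(1) yh(1) by simp
    qed
  qed
qed

section \<open>Best responses when every blocking edge uses free quota of its job\<close>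

context
  fixes x j e y
  assumes x: "allocation I x" and nb: "no_better_blocking I x" and j: "j \<in> blocking_jobs I x"
    and e_def: "e = best_blocking_edge I x j" and y_def: "y = best_response I x j"
begin

text \<open>A lost edge was in use before. If the loss were charged to the job, the blocking edge
  \<open>e\<close> would dominate a used edge there, against
  \<open>no_better_blocking\<close>.\<close>

lemma best_response_no_job_loss:
  assumes "f \<in> edges I" "y f < x f"
  shows "snd f = snd e"
proof -
  have ex: "exchange I x e y" unfolding e_def y_def by (rule exchange_best_response[OF x j])
  note e = exchangeD(1)[OF ex]
  obtain v where v: "v = fst e \<or> v = snd e" "f \<in> incident I v" "dominates I v e f"
    using exchange_loss[OF ex assms] by blast
  have "0 \<le> y f" using exchangeD(3)[OF ex] assms(1) by (simp add: allocation_def)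
  then have "0 < x f" using assms(2) by simp
  moreover have "blocks I x e" unfolding e_def by (rule best_blocking_edge(1)[OF j])
  ultimately have "v \<noteq> fst e"
    using nb v(2,3) unfolding no_better_blocking_def by blast
  then have "f \<in> incident I (snd e)" using v by simp
  then show ?thesis using edge_ends[OF e] by (simp add: incident_machine)
qed

text \<open>Machines only become choosier. Away from \<open>e\<close> nothing changes; at the
  machine of \<open>e\<close> the load does not fall, and the only edge that gains is
  \<open>e\<close>, which the machine wanted already.\<close>

lemma wants_machine_mono:
  assumes m: "m \<in> machines I" and w: "wants I y m f"
  shows "wants I x m f"
proof (cases "m = snd e")
  case False
  have ex: "exchange I x e y" unfolding e_def y_def by (rule exchange_best_response[OF x j])
  have "y g = x g" if "g \<in> incident I m" for g
  proof -
    have g: "g \<in> edges I" "snd g = m" using that m by (simp_all add: incident_machine)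
    then have "g \<noteq> e" using False by auto
    then show ?thesis
      using best_response_no_job_loss[OF g(1)] exchangeD(4)[OF ex g(1)] g(2) False by fastforce
  qed
  then show ?thesis using w by (simp add: wants_iff load_def)
next
  case True
  have ex: "exchange I x e y" unfolding e_def y_def by (rule exchange_best_response[OF x j])
  have "wants I x m e"
    using best_blocking_edge(1)[OF j] by (simp add: e_def True blocks_def)
  consider "load I y m < quota I m" | g where "g \<in> incident I m" "0 < y g" "dominates I m f g"
    using w by (auto simp: wants_iff)
  then show ?thesis
  proof cases
    case 1
    then show ?thesis using exchangeD(6)[OF ex] True by (simp add: wants_iff)
  next
    case 2
    show ?thesis
    proof (cases "g = e")
      case True
      then show ?thesis
        using \<open>wants I x m e\<close> 2(3) by (auto simp: wants_iff dominates_def intro: less_trans)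
    next
      case False
      then have "0 < x g" using 2(2) exchangeD(4)[OF ex incident_edges[OF 2(1)]] by simp
      then show ?thesis using 2 by (auto simp: wants_iff)
    qed
  qed
qed

text \<open>An edge \<open>f\<close> violating the condition in \<open>y\<close> would already block
  \<open>x\<close>: its machine wanted it before, and its capacity was not exhausted. This
  contradicts either the condition for \<open>x\<close> or the choice of \<open>e\<close>.\<close>

lemma no_better_blocking_best_response: "no_better_blocking I y"
  unfolding no_better_blocking_def
proof (intro allI impI notI)
  fix f g
  assume bf: "blocks I y f" and g: "g \<in> incident I (fst f)" "0 < y g" "dominates I (fst f) f g"
  have ex: "exchange I x e y" unfolding e_def y_def by (rule exchange_best_response[OF x j])
  note e = exchangeD(1)[OF ex]
  have be: "blocks I x e" "fst e = j"
    using best_blocking_edge[OF j] by (simp_all add: e_def)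
  have f: "f \<in> edges I" "y f < capacity I f" "wants I y (snd f) f"
    using bf by (simp_all add: blocks_def)
  have gE: "g \<in> edges I" using g(1) by (rule incident_edges)
  have w_m: "wants I x (snd f) f"
    by (rule wants_machine_mono[OF _ f(3)]) (use edge_ends[OF f(1)] in simp)
  \<comment> \<open>After a loss at \<open>f\<close> its machine is full and uses nothing worse, so
    it would not want \<open>f\<close>.\<close>
  have "\<not> y f < x f"
  proof
    assume lt: "y f < x f"
    have m: "snd f = snd e" using best_response_no_job_loss[OF f(1) lt] .
    show False
      using f(3) exchange_machine_loss[OF ex f(1) lt m] by (auto simp: wants_iff m)
  qed
  moreover have "x e < y e" by (rule exchangeD(2)[OF ex])
  ultimately have cap: "x f < capacity I f"
    using f(2) by (cases "f = e") auto
  have g_pos: "0 < x g" if "g \<noteq> e"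
    using that g(2) exchangeD(4)[OF ex gE] by simp
  have "wants I x (fst f) f \<and> g \<noteq> e"
  proof (cases "g = e")
    case False
    then show ?thesis using g g_pos by (auto simp: wants_iff)
  next
    case True
    \<comment> \<open>Here \<open>f\<close> beats \<open>e\<close> itself. As \<open>j\<close>
      wanted \<open>e\<close> through free quota alone, it wanted \<open>f\<close> in
      \<open>x\<close> as well, so \<open>e\<close> was not its best blocking edge.\<close>
    have fj: "fst f = j"
      using g(1) edge_ends(1)[OF f(1)] True be(2) by (simp add: incident_job)
    have "wants I x j e" using be by (simp add: blocks_def)
    then have "load I x j < quota I j"
      using nb be unfolding no_better_blocking_def wants_iff by blast
    then have "blocks I x f"
      using f(1) cap w_m fj by (simp add: blocks_def wants_iff)
    moreover have "f \<in> incident I j" using edge_ends(3)[OF f(1)] fj by simp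
    ultimately have "ranking I j e \<le> ranking I j f"
      unfolding e_def by (intro best_blocking_edge(3)[OF j])
    then show ?thesis using g(3) True fj by (simp add: dominates_def)
  qed
  then have "blocks I x f" "0 < x g"
    using f(1) cap w_m g_pos by (simp_all add: blocks_def)
  then show False using nb g unfolding no_better_blocking_def by blast
qed

end

section \<open>Reachability of stable allocations\<close>

definition "response_step = {(x, y). \<exists>j\<in>blocking_jobs I x. y = best_response I x j}"

lemma blocking_job: "blocks I x e \<Longrightarrow> fst e \<in> blocking_jobs I x"
  using edge_ends[of e] by (auto simp: blocking_jobs_def blocks_def)

text \<open>Extremal states of finite reachable sets replace running the two phases. A lexicographic
  minimum reached from \<open>x\<close> satisfies \<open>no_better_blocking\<close>, as otherwise
  one more move would lower it. The invariant persists from there, and a maximum of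
  \<open>machine_potential\<close> allows no move, as each move would raise it.\<close>

lemma stable_reachable:
  assumes fin: "finite R" and alloc: "\<And>x. x \<in> R \<Longrightarrow> allocation I x"
    and closed: "\<And>x j. x \<in> R \<Longrightarrow> j \<in> blocking_jobs I x \<Longrightarrow> best_response I x j \<in> R"
    and x: "x \<in> R"
  shows "\<exists>t. stable_allocation I t \<and> (x, t) \<in> response_step\<^sup>*"
proof -
  have step_R: "z \<in> R" if "y \<in> R" "(y, z) \<in> response_step\<^sup>*" for y z
    using that(2,1) by induction (auto simp: response_step_def closed)
  define R1 where "R1 = {y. (x, y) \<in> response_step\<^sup>*}"
  have "R1 \<subseteq> R" using step_R[OF x] by (auto simp: R1_def)
  then have R1: "finite R1" "R1 \<noteq> {}" using fin finite_subset by (auto simp: R1_def)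
  obtain y where y: "y \<in> R1"
    and min: "\<And>z. z \<in> R1 \<Longrightarrow> covered_count I z \<le> covered_count I y \<Longrightarrow>
      (covered_count I z = covered_count I y \<Longrightarrow> lowest_value I z \<le> lowest_value I y) \<Longrightarrow>
      covered_count I z = covered_count I y \<and> lowest_value I z = lowest_value I y \<and>
      - machine_potential I y \<le> - machine_potential I z"
    using finite_lex_minimum[OF R1, where f="covered_count I" and g="lowest_value I"
        and h="\<lambda>z. - machine_potential I z"] by metis
  have yR: "y \<in> R" using y \<open>R1 \<subseteq> R\<close> by blast
  have nb: "no_better_blocking I y"
    unfolding no_better_blocking_def
  proof (intro allI impI notI)
    fix e g
    assume e: "blocks I y e" and g: "g \<in> incident I (fst e)" "0 < y g" "dominates I (fst e) e g"
    define j where "j = fst e"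
    have j: "j \<in> blocking_jobs I y" using blocking_job[OF e] by (simp add: j_def)
    define b z where "b = best_blocking_edge I y j" and "z = best_response I y j"
    have ex: "exchange I y b z"
      unfolding b_def z_def by (rule exchange_best_response[OF alloc[OF yR] j])
    \<comment> \<open>The job may move along another edge than \<open>e\<close>, but its best
      blocking edge is at least as good and so also beats \<open>g\<close>.\<close>
    have "ranking I j b \<le> ranking I j e"
      unfolding b_def using e edge_ends[of e]
      by (intro best_blocking_edge(3)[OF j]) (simp_all add: j_def blocks_def)
    then have "dominates I (fst b) b g" "g \<in> incident I (fst b)"
      using g best_blocking_edge(2)[OF j] by (simp_all add: dominates_def j_def b_def)
    note progress = exchange_better_progress[OF ex this(2) g(2) this(1)]
    have "(y, z) \<in> response_step" using j by (auto simp: response_step_def z_def)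
    then have "z \<in> R1" using y by (auto simp: R1_def)
    with min[OF this progress(1,2)] progress(3) show False by simp
  qed
  define R2 where "R2 = {z. (y, z) \<in> response_step\<^sup>*}"
  have "R2 \<subseteq> R" using step_R[OF yR] by (auto simp: R2_def)
  then have R2: "finite R2" "R2 \<noteq> {}" using fin finite_subset by (auto simp: R2_def)
  define t where "t = arg_min_on (\<lambda>z. - machine_potential I z) R2"
  have t: "t \<in> R2" unfolding t_def using R2 by (rule arg_min_if_finite(1))
  have max: "machine_potential I z \<le> machine_potential I t" if "z \<in> R2" for z
    using arg_min_least[OF R2 that, of "\<lambda>z. - machine_potential I z"] by (simp add: t_def)
  have nb2: "no_better_blocking I z" if "(y, z) \<in> response_step\<^sup>*" for z
    using that
  proof induction
    case (step z z')
    have "allocation I z" using step_R[OF yR step.hyps(1)] by (rule alloc)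
    then show ?case
      using step.hyps(2) step.IH no_better_blocking_best_response[OF _ _ _ refl refl]
      by (auto simp: response_step_def)
  qed (rule nb)
  have tR: "allocation I t" using t \<open>R2 \<subseteq> R\<close> alloc by blast
  have nbt: "no_better_blocking I t" using t nb2 by (simp add: R2_def)
  have "\<not> blocks I t e" for e
  proof
    assume "blocks I t e"
    then have j: "fst e \<in> blocking_jobs I t" by (rule blocking_job)
    have "machine_potential I t < machine_potential I (best_response I t (fst e))"
      by (rule machine_potential_increases[OF exchange_best_response[OF tR j]])
        (rule best_response_no_job_loss[OF tR nbt j refl refl])
    moreover have "(t, best_response I t (fst e)) \<in> response_step"
      using j by (auto simp: response_step_def)
    then have "best_response I t (fst e) \<in> R2" using t by (auto simp: R2_def)
    ultimately show False using max by fastforce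
  qed
  then have "stable_allocation I t" using tR by (simp add: stable_allocation_def)
  moreover have "(x, t) \<in> response_step\<^sup>*" using y t by (auto simp: R1_def R2_def)
  ultimately show ?thesis by blast
qed

end

section \<open>Finiteness from a common denominator\<close>

lemma common_denominator:
  fixes S :: "real set"
  assumes "finite S" "S \<subseteq> \<rat>"
  obtains N :: nat where "0 < N" "\<And>r. r \<in> S \<Longrightarrow> r * real N \<in> \<int>"
proof -
  have "\<exists>N>0. \<forall>r\<in>S. r * real N \<in> \<int>"
    using assms
  proof (induction S rule: finite_induct)
    case empty
    show ?case by (rule exI[of _ 1]) simp
  next
    case (insert s S)
    then obtain N where N: "N > 0" "\<forall>r\<in>S. r * real N \<in> \<int>" by auto
    obtain a b where ab: "b > 0" "s = of_int a / of_int b"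
      using insert.prems by (auto elim!: Rats_cases')
    define k where "k = nat b"
    have k: "0 < k" "s * real k = of_int a" using ab by (simp_all add: k_def)
    have "s * real (N * k) \<in> \<int>"
      using k(2) by (simp add: mult.left_commute[of s] mult.assoc)
    moreover have "r * real (N * k) \<in> \<int>" if "r \<in> S" for r
      using N(2) that by (simp add: mult.assoc[symmetric])
    ultimately show ?case using N(1) k(1) by (intro exI[of _ "N * k"]) auto
  qed
  then show thesis using that by blast
qed

lemma finite_scaled_ints:
  fixes c :: real
  assumes "0 < N"
  shows "finite {r. r * real N \<in> \<int> \<and> 0 \<le> r \<and> r \<le> c}"
proof (rule finite_subset)
  show "{r. r * real N \<in> \<int> \<and> 0 \<le> r \<and> r \<le> c} \<subseteq>
      (\<lambda>k. real_of_int k / real N) ` {0..\<lfloor>c * real N\<rfloor>}"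
  proof
    fix r assume "r \<in> {r. r * real N \<in> \<int> \<and> 0 \<le> r \<and> r \<le> c}"
    then obtain k where k: "r * real N = of_int k" and r: "0 \<le> r" "r \<le> c" by (auto elim: Ints_cases)
    have "0 \<le> real_of_int k" "real_of_int k \<le> c * real N"
      unfolding k[symmetric] using r by (simp_all add: mult_right_mono)
    then have "k \<in> {0..\<lfloor>c * real N\<rfloor>}" by (simp add: le_floor_iff)
    moreover have "r = of_int k / real N" using k assms by (simp add: field_simps)
    ultimately show "r \<in> (\<lambda>k. real_of_int k / real N) ` {0..\<lfloor>c * real N\<rfloor>}" by blast
  qed
qed simp

lemma finite_functions_agreeing_off:
  assumes "finite A" "\<And>a. a \<in> A \<Longrightarrow> finite (B a)"
  shows "finite {f. (\<forall>a\<in>A. f a \<in> B a) \<and> (\<forall>a. a \<notin> A \<longrightarrow> f a = g a)}"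
proof (rule finite_subset)
  show "{f. (\<forall>a\<in>A. f a \<in> B a) \<and> (\<forall>a. a \<notin> A \<longrightarrow> f a = g a)} \<subseteq>
      (\<lambda>h a. if a \<in> A then h a else g a) ` PiE A B"
  proof
    fix f assume f: "f \<in> {f. (\<forall>a\<in>A. f a \<in> B a) \<and> (\<forall>a. a \<notin> A \<longrightarrow> f a = g a)}"
    then have "f = (\<lambda>a. if a \<in> A then restrict f A a else g a)" "restrict f A \<in> PiE A B"
      by (auto simp: fun_eq_iff)
    then show "f \<in> (\<lambda>h a. if a \<in> A then h a else g a) ` PiE A B" by (rule image_eqI)
  qed
qed (use assms in \<open>simp add: finite_PiE\<close>)

section \<open>Almost sure termination of the dynamics\<close>

theorem theorem5:
  fixes I :: "'v alloc_instance"
    and x\<^sub>0 :: "'v assignment"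
    and S :: "'v assignment \<Rightarrow> 'v pmf"
    and \<Omega> :: "'w measure"
    and X :: "nat \<Rightarrow> 'w \<Rightarrow> 'v assignment"
  assumes "stable_allocation_instance I"
    and "rational_data I"
    and "rational_allocation I x\<^sub>0"
    and "selection_rule I S"
    and "markov_chain (dynamics_kernel I S) x\<^sub>0 \<Omega> X"
  shows "AE \<omega> in \<Omega>. \<exists>n. stable_allocation I (X n \<omega>)"
proof -
  interpret instance_context I by unfold_locales fact
  let ?V = "jobs I \<union> machines I"
  have "finite ?V" using assms(1) by (simp add: stable_allocation_instance_def)
  then obtain N where N: "0 < N" and
    int: "\<And>r. r \<in> quota I ` ?V \<union> capacity I ` edges I \<union> x\<^sub>0 ` edges I \<Longrightarrow> r * real N \<in> \<int>"
    using common_denominator[of "quota I ` ?V \<union> capacity I ` edges I \<union> x\<^sub>0 ` edges I"]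
      assms(2,3) finite_edges
    by (auto simp: rational_data_def rational_allocation_def image_subset_iff)
  define G where "G = {r. r * real N \<in> \<int>}"
  \<comment> \<open>A finite closed superset of the reachable allocations suffices: those with
    values on the grid of step \<open>1 / N\<close> that agree with the initial one off the edge
    set.\<close>
  define R where "R = {x. allocation I x \<and> (\<forall>e\<in>edges I. x e \<in> G) \<and> (\<forall>e. e \<notin> edges I \<longrightarrow> x e = x\<^sub>0 e)}"
  have fin: "finite R"
  proof (rule finite_subset)
    show "R \<subseteq> {x. (\<forall>e\<in>edges I. x e \<in> {r. r * real N \<in> \<int> \<and> 0 \<le> r \<and> r \<le> capacity I e}) \<and>
        (\<forall>e. e \<notin> edges I \<longrightarrow> x e = x\<^sub>0 e)}"
      by (auto simp: R_def G_def allocation_def)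
  qed (intro finite_functions_agreeing_off finite_edges finite_scaled_ints N)
  have x0: "x\<^sub>0 \<in> R"
    using assms(3) int by (auto simp: R_def G_def rational_allocation_def)
  have alloc: "allocation I x" if "x \<in> R" for x
    using that by (simp add: R_def)
  have closed: "best_response I x j \<in> R" if x: "x \<in> R" and j: "j \<in> blocking_jobs I x" for x j
  proof -
    have "\<forall>e\<in>edges I. best_response I x j e \<in> G"
      by (rule best_response_closed[OF _ _ _ _ _ j])
        (use x int in \<open>auto simp: R_def G_def left_diff_distrib\<close>)
    then show ?thesis
      using exchangeD(3)[OF exchange_best_response[OF alloc[OF x] j]] best_response_off_edges[OF j] x
      by (simp add: R_def)
  qed
  let ?K = "dynamics_kernel I S"
  \<comment> \<open>Each blocking job is chosen with positive probability, so in an unstable state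
    the support consists of all best responses.\<close>
  have support: "set_pmf (?K x) = (if stable_allocation I x then {x} else best_response I x ` blocking_jobs I x)"
    if "x \<in> R" for x
    using assms(4) alloc[OF that] by (simp add: dynamics_kernel_def selection_rule_def)
  have "AE \<omega> in \<Omega>. \<exists>n. X n \<omega> \<in> {x. stable_allocation I x}"
  proof (rule markov_chain_absorbed[OF assms(5) fin x0])
    show "set_pmf (?K y) \<subseteq> R" if "y \<in> R" for y
      using that closed[OF that] by (auto simp: support)
    show "?K y = return_pmf y" if "y \<in> {x. stable_allocation I x}" for y
      using that by (simp add: dynamics_kernel_def)
    fix y assume y: "y \<in> R"
    obtain t where t: "stable_allocation I t" "(y, t) \<in> response_step\<^sup>*"
      using stable_reachable[OF fin alloc closed y] by blast
    \<comment> \<open>Membership in \<open>R\<close> is carried through the induction because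
      \<open>support\<close> speaks only about states in \<open>R\<close>.\<close>
    have "(y, t) \<in> {(a, b). b \<in> set_pmf (?K a)}\<^sup>* \<and> t \<in> R"
      using t(2)
    proof induction
      case (step z z')
      then obtain j where j: "j \<in> blocking_jobs I z" "z' = best_response I z j"
        by (auto simp: response_step_def)
      have "\<not> stable_allocation I z"
        using j(1) incident_edges by (auto simp: stable_allocation_def blocking_jobs_def)
      then have "z' \<in> set_pmf (?K z)" using j step.IH by (simp add: support)
      then show ?case using step.IH j closed by (auto intro: rtrancl_into_rtrancl)
    qed (simp add: y)
    then show "\<exists>t\<in>{x. stable_allocation I x}. (y, t) \<in> {(a, b). b \<in> set_pmf (?K a)}\<^sup>*"
      using t(1) by blast
  qed
  then show ?thesis by simp
qed

end
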